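(* Let $A_1,A_2,C\in\mathbf{S}_+(n)$, and without loss of generality suppose that $A_1$ is the matrix in the geodesic $\varphi_{A_1\to A_2}$ that minimizes the distance $d\big(\varphi_{A_1\to A_2}(t),C\big)$. As functions of $\epsilon=d\big(\varphi_{A_1\to A_2}(t),C\big)$, let $\hat\Delta t(\epsilon)$ be the difference between the solutions of the reverse I-projection and natural projection problems, and $\check\Delta t(\epsilon)$ the difference between the solutions of the I-projection and natural projection problems. Then the $i$-th derivatives of $\hat\Delta t$ and $\check\Delta t$ satisfy $$\hat\Delta t^{(i)}(0)=\check\Delta t^{(i)}(0),\quad i=1,3,5,\dots,\qquad \hat\Delta t^{(i)}(0)=-\check\Delta t^{(i)}(0),\quad i=0,2,4,6,\dots.$$ Thus, the Taylor expansion of the difference in the solutions of the reverse I-projection and I-projection problems as a function of $\epsilon=d(\varphi_{A_1\to A_2}(t),C)$, in a neighborhood of $\epsilon=0$, always attains one additional order of accuracy. In particular, $$\hat t(\epsilon)-\check t(\epsilon)=\hat\Delta t''(0)\,\epsilon^2+\mathcal{O}(\epsilon^4),$$ where $$\hat\Delta t''(0)=\frac{\operatorname{tr}\Big(\log_m^2\big(A_1^{-1/2}CA_1^{-1/2}\big)\,\log_m\big(A_1^{-1/2}A_2A_1^{-1/2}\big)\Big)}{d(A_1,A_2)}.$$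
   Context: $\mathbf{S}_+(n)$ is the manifold of real symmetric positive-definite $n\times n$ matrices. $\log_m$ is the matrix logarithm, $\log_m^2(X)=(\log_m X)^2$, and square roots are symmetric. Natural distance: $d(A,B)=\|\log_m(A^{-1/2}BA^{-1/2})\|_F$. Geodesic: $\varphi_{A\to B}(t)=A^{1/2}(A^{-1/2}BA^{-1/2})^{t}A^{1/2}$, $t\in\mathbb{R}$. For a matrix $\widehat C\in\mathbf{S}_+(n)$ to be projected, the three problems over $t\in(-\infty,\infty)$ and their solutions are: - natural projection: $t^*\in\operatorname{argmin}_t d(\varphi_{A_1\to A_2}(t),\widehat C)$; - reverse I-projection: $\hat t\in\operatorname{argmin}_t D_{KL}\big(N(0,\widehat C)\,\|\,N(0,\varphi_{A_1\to A_2}(t))\big)$; - I-projection: $\check t\in\operatorname{argmin}_t D_{KL}\big(N(0,\varphi_{A_1\to A_2}(t))\,\|\,N(0,\widehat C)\big)$. Here $D_{KL}$ is the Kullback–Leibler divergence, $D_{KL}(N(0,A)\,\|\,N(0,B))=\tfrac12\big(\operatorname{tr}(B^{-1}A)-n-\log\det(B^{-1}A)\big)$. The differences are $\hat\Delta t=\hat t-t^*$ and $\check\Delta t=\check t-t^*$, regarded as functions of the natural distance $\epsilon$ from the family to the matrix being projected. With orthogonal eigendecompositions $V\Sigma V^\top=A_1^{-1/2}CA_1^{-1/2}$ and $U\Lambda U^\top=A_1^{-1/2}A_2A_1^{-1/2}$, they are defined implicitly by $$\operatorname{tr}\big((U^\top V\Sigma^{\epsilon}V^\top U\Lambda^{\hat\Delta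 t(\epsilon)}-\mathrm{Id})\log_m(\Lambda)\big)=0,\qquad \operatorname{tr}\big((\Lambda^{-\check\Delta t(\epsilon)}U^\top V\Sigma^{-\epsilon}V^\top U-\mathrm{Id})\log_m(\Lambda)\big)=0.$$ (In the supporting construction, the projected matrix at distance $\epsilon$ is $\varphi_{A_1\to\widehat C}(\epsilon)$, the point at parameter $\epsilon$ on the geodesic from $A_1$ through a matrix $\widehat C$ with $d(A_1,\widehat C)=1$.)
   Formalization: The denominator of the formula for the second derivative of Δt̂ at 0 is d(A_1,A_2)^2, since the printed d(A_1,A_2) is wrong unless d(A_1,A_2)=1 or the trace vanishes; A_1≠A_2 is assumed, and ε is the parameter on the geodesic from A_1 through C, the distance when d(A_1,C)=1. *)

theory Defs
  imports "HOL-Analysis.Analysis" "HOL-Library.Landau_Symbols"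
begin

definition SPD :: "(real^'n^'n) set" where
  "SPD = {A. transpose A = A \<and> (\<forall>x. x \<noteq> 0 \<longrightarrow> x \<bullet> (A *v x) > 0)}"

definition diag :: "real^'n \<Rightarrow> real^'n^'n" where
  "diag d = (\<chi> i j. if i = j then d $ i else 0)"

(* Spectral functional calculus f(A) = Q f(D) Q^T for an orthogonal eigendecomposition
   A = Q D Q^T of a symmetric matrix; by sym_fun_eq below it does not depend on the
   decomposition. *)
definition sym_fun :: "(real \<Rightarrow> real) \<Rightarrow> real^'n^'n \<Rightarrow> real^'n^'n" where
  "sym_fun f A = (THE B. \<exists>Q d. orthogonal_matrix Q \<and> A = Q ** diag d ** transpose Q \<and>
                              B = Q ** diag (\<chi> i. f (d $ i)) ** transpose Q)"

lemma diag_mult_nth: "(diag d ** W) $ i $ j = d $ i * W $ i $ j"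
proof -
  have "(diag d ** W) $ i $ j = (\<Sum>k\<in>UNIV. if i = k then d $ i * W $ k $ j else 0)"
    unfolding matrix_matrix_mult_def diag_def
    by (simp only: vec_lambda_beta) (rule sum.cong; simp)
  then show ?thesis by simp
qed

lemma mult_diag_nth: "(W ** diag d) $ i $ j = W $ i $ j * d $ j"
proof -
  have "(W ** diag d) $ i $ j = (\<Sum>k\<in>UNIV. if k = j then W $ i $ k * d $ k else 0)"
    unfolding matrix_matrix_mult_def diag_def
    by (simp only: vec_lambda_beta) (rule sum.cong; simp)
  then show ?thesis by simp
qed

lemma sym_fun_unique:
  fixes P Q :: "real^'n^'n"
  assumes P: "orthogonal_matrix P" and Q: "orthogonal_matrix Q"
    and eq: "P ** diag c ** transpose P = Q ** diag d ** transpose Q"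
  shows "P ** diag (\<chi> i. f (c $ i)) ** transpose P = Q ** diag (\<chi> i. f (d $ i)) ** transpose Q"
proof -
  define W where "W = transpose Q ** P"
  have PP: "transpose P ** P = mat 1" "P ** transpose P = mat 1"
    and QQ: "transpose Q ** Q = mat 1" "Q ** transpose Q = mat 1"
    using P Q by (auto simp: orthogonal_matrix_def)
  have "W ** diag c = transpose Q ** (P ** diag c ** transpose P) ** P"
    by (simp add: W_def PP flip: matrix_mul_assoc)
  also have "\<dots> = (transpose Q ** Q) ** diag d ** (transpose Q ** P)"
    unfolding eq by (simp add: matrix_mul_assoc)
  also have "\<dots> = diag d ** W"
    by (simp add: QQ W_def)
  finally have "W $ i $ j * c $ j = d $ i * W $ i $ j" for i j
    by (metis diag_mult_nth mult_diag_nth)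
  then have "W $ i $ j * f (c $ j) = f (d $ i) * W $ i $ j" for i j
    by (metis mult.commute mult_cancel_left)
  then have W: "W ** diag (\<chi> i. f (c $ i)) = diag (\<chi> i. f (d $ i)) ** W"
    by (simp add: vec_eq_iff diag_mult_nth mult_diag_nth)
  have "P ** diag (\<chi> i. f (c $ i)) ** transpose P
      = (Q ** transpose Q) ** P ** diag (\<chi> i. f (c $ i)) ** transpose P"
    by (simp add: QQ)
  also have "\<dots> = Q ** (W ** diag (\<chi> i. f (c $ i))) ** transpose P"
    by (simp add: W_def matrix_mul_assoc)
  also have "\<dots> = Q ** diag (\<chi> i. f (d $ i)) ** transpose Q ** (P ** transpose P)"
    unfolding W by (simp add: W_def matrix_mul_assoc)
  finally show ?thesis by (simp add: PP)
qed

lemma sym_fun_eq: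
  fixes Q :: "real^'n^'n"
  assumes "orthogonal_matrix Q"
  shows "sym_fun f (Q ** diag d ** transpose Q) = Q ** diag (\<chi> i. f (d $ i)) ** transpose Q"
  unfolding sym_fun_def
proof (rule the_equality)
  show "\<exists>P c. orthogonal_matrix P \<and> Q ** diag d ** transpose Q = P ** diag c ** transpose P \<and>
          Q ** diag (\<chi> i. f (d $ i)) ** transpose Q = P ** diag (\<chi> i. f (c $ i)) ** transpose P"
    using assms by blast
next
  fix B
  assume "\<exists>P c. orthogonal_matrix P \<and> Q ** diag d ** transpose Q = P ** diag c ** transpose P \<and>
            B = P ** diag (\<chi> i. f (c $ i)) ** transpose P"
  then show "B = Q ** diag (\<chi> i. f (d $ i)) ** transpose Q"
    using sym_fun_unique[OF assms] by metis
qed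

definition log_m :: "real^'n^'n \<Rightarrow> real^'n^'n" where
  "log_m = sym_fun ln"

definition mpow :: "real^'n^'n \<Rightarrow> real \<Rightarrow> real^'n^'n" where
  "mpow A t = sym_fun (\<lambda>x. x powr t) A"

(* A^(-1/2) B A^(-1/2) *)
definition whiten :: "real^'n^'n \<Rightarrow> real^'n^'n \<Rightarrow> real^'n^'n" where
  "whiten A B = mpow A (- 1/2) ** B ** mpow A (- 1/2)"

(* the library norm on real^'n^'n is the Frobenius norm *)
definition nat_dist :: "real^'n^'n \<Rightarrow> real^'n^'n \<Rightarrow> real" where
  "nat_dist A B = norm (log_m (whiten A B))"

definition geodesic :: "real^'n^'n \<Rightarrow> real^'n^'n \<Rightarrow> real \<Rightarrow> real^'n^'n" where
  "geodesic A B t = mpow A (1/2) ** mpow (whiten A B) t ** mpow A (1/2)"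

(* D_KL (N(0,A) || N(0,B)) in closed form *)
definition KL_normal :: "real^'n^'n \<Rightarrow> real^'n^'n \<Rightarrow> real" where
  "KL_normal A B =
     (trace (matrix_inv B ** A) - real CARD('n) - ln (det (matrix_inv B ** A))) / 2"

(* The three projections of C onto the geodesic family through A1 and A2, as parameters. *)

definition natural_proj :: "real^'n^'n \<Rightarrow> real^'n^'n \<Rightarrow> real^'n^'n \<Rightarrow> real" where
  "natural_proj A1 A2 C = (ARG_MIN (\<lambda>t::real. nat_dist (geodesic A1 A2 t) C) t. True)"

definition reverse_I_proj :: "real^'n^'n \<Rightarrow> real^'n^'n \<Rightarrow> real^'n^'n \<Rightarrow> real" where
  "reverse_I_proj A1 A2 C = (ARG_MIN (\<lambda>t::real. KL_normal C (geodesic A1 A2 t)) t. True)"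

definition I_proj :: "real^'n^'n \<Rightarrow> real^'n^'n \<Rightarrow> real^'n^'n \<Rightarrow> real" where
  "I_proj A1 A2 C = (ARG_MIN (\<lambda>t::real. KL_normal (geodesic A1 A2 t) C) t. True)"

(* The projected matrix is the point with parameter \<epsilon> on the geodesic from A1 through C,
   which is at distance |\<epsilon>| from A1 when nat_dist A1 C = 1; \<epsilon> ranges over all reals, so
   that derivatives at 0 are two-sided. *)

definition t_star :: "real^'n^'n \<Rightarrow> real^'n^'n \<Rightarrow> real^'n^'n \<Rightarrow> real \<Rightarrow> real" where
  "t_star A1 A2 C \<epsilon> = natural_proj A1 A2 (geodesic A1 C \<epsilon>)"

definition t_hat :: "real^'n^'n \<Rightarrow> real^'n^'n \<Rightarrow> real^'n^'n \<Rightarrow> real \<Rightarrow> real" where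
  "t_hat A1 A2 C \<epsilon> = reverse_I_proj A1 A2 (geodesic A1 C \<epsilon>)"

definition t_check :: "real^'n^'n \<Rightarrow> real^'n^'n \<Rightarrow> real^'n^'n \<Rightarrow> real \<Rightarrow> real" where
  "t_check A1 A2 C \<epsilon> = I_proj A1 A2 (geodesic A1 C \<epsilon>)"

definition Dt_hat :: "real^'n^'n \<Rightarrow> real^'n^'n \<Rightarrow> real^'n^'n \<Rightarrow> real \<Rightarrow> real" where
  "Dt_hat A1 A2 C \<epsilon> = t_hat A1 A2 C \<epsilon> - t_star A1 A2 C \<epsilon>"

definition Dt_check :: "real^'n^'n \<Rightarrow> real^'n^'n \<Rightarrow> real^'n^'n \<Rightarrow> real \<Rightarrow> real" where
  "Dt_check A1 A2 C \<epsilon> = t_check A1 A2 C \<epsilon> - t_star A1 A2 C \<epsilon>"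

(* f^(i)(0) is (deriv ^^ i) f 0; deriv is total, so existence of all derivatives near 0
   is a separate claim. *)
definition smooth_near_0 :: "(real \<Rightarrow> real) \<Rightarrow> bool" where
  "smooth_near_0 f \<longleftrightarrow>
     (\<exists>\<delta>>0. \<forall>i. \<forall>x. \<bar>x\<bar> < \<delta> \<longrightarrow> (deriv ^^ i) f field_differentiable at x)"

end

(*
  Write L and K for the logarithms of whiten A1 A2 and whiten A1 C, w_ij for the squared inner
  products of their eigenvectors, and l_j, k_i for their eigenvalues.

  The natural distance dominates the Euclidean distance of logarithms (exponential metric increasing
  property). Minimality of A1 forces <K, L> = 0, so Pythagoras shows that A1 stays the unique nearest
  point to every matrix on the geodesic from A1 to C, and the natural projection is constantly 0.

  The divergences are sum_ij w_ij psi(e k_i - t l_j) / 2 and the same expression at (-e, -t), with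
  psi x = exp x - 1 - x. They are strictly convex in t, so the two minimisers satisfy
  t_check(e) = - t_hat(- e), which gives the parity relations and makes t_hat - t_check even.
  Differentiating the stationarity equation sum_ij w_ij l_j (exp(e k_i - t l_j) - 1) = 0 twice at 0
  gives the second derivative.
*)
theory Submission
  imports Defs "HOL-Real_Asymp.Real_Asymp"
begin

section \<open>Orthogonal diagonalization\<close>

text \<open>The natural distance is never differentiated. Its square and the squared Euclidean
  distance of logarithms are both bounded by \<open>sym_KL\<close>, which has closed forms in a
  common congruence frame and in two separate eigenbases. The underlying scalar bound x^2 <= 2 cosh
  x - 2 is sharp to second order at 0, so nothing is lost in the limit of small steps: this yields
  both the metric increasing property and the first-order condition at A1. Smoothness of the
  minimiser needs no bound on its derivatives: the stationarity equation is solved for a difference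
  quotient whose denominator stays positive, and the resulting formula lies in an algebra closed
  under differentiation. All derivatives therefore exist on the whole line. The distance from A1 to
  C is not normalised to 1: the matrix at parameter e lies at distance |e| d(A1,C) from A1. In the
  second derivative the denominator is the sum of the l_j^2, which is the square of
  d(A1,A2).\<close>

lemma linear_term_zero:
  fixes b c :: real
  assumes "\<And>t. 0 \<le> 2 * t * b + t\<^sup>2 * c"
  shows "b = 0"
proof (rule ccontr)
  assume "b \<noteq> 0"
  \<comment> \<open>The sign of \<open>c\<close> is unknown, so the minimising \<open>t\<close> is
    taken for a positive upper bound of it.\<close>
  define C where "C = \<bar>c\<bar> + 1"
  have C: "C > 0" "c \<le> C" by (auto simp: C_def)
  have "0 \<le> 2 * (- b / C) * b + (- b / C)\<^sup>2 * c" by (rule assms)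
  also have "\<dots> \<le> 2 * (- b / C) * b + (- b / C)\<^sup>2 * C"
    using C by (intro add_left_mono mult_left_mono) auto
  also have "\<dots> = - b\<^sup>2 / C" using C by (simp add: field_simps power2_eq_square)
  also have "\<dots> < 0" using C \<open>b \<noteq> 0\<close> by simp
  finally show False by simp
qed

lemma symmetric_inner_swap:
  fixes A :: "real^'n^'n"
  assumes "transpose A = A"
  shows "x \<bullet> (A *v y) = (A *v x) \<bullet> y"
  using assms by (metis dot_lmul_matrix vector_transpose_matrix)

text \<open>A maximiser of the Rayleigh quotient on the unit sphere is an eigenvector. The version
  for an invariant subspace serves to extend an orthonormal family of eigenvectors inside its
  orthogonal complement.\<close>

lemma symmetric_eigenvector_exists:
  fixes A :: "real^'n^'n"
  assumes sym: "transpose A = A" and S: "subspace S" "S \<noteq> {0}"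
    and inv: "\<And>x. x \<in> S \<Longrightarrow> A *v x \<in> S"
  shows "\<exists>x\<in>S. \<exists>c. norm x = 1 \<and> A *v x = c *\<^sub>R x"
proof -
  let ?K = "S \<inter> sphere 0 1"
  obtain z where z: "z \<in> S" "z \<noteq> 0" using S subspace_0 by blast
  have "z /\<^sub>R norm z \<in> ?K" using z S by (simp add: subspace_scale)
  moreover have "compact ?K" using S closed_subspace by (intro closed_Int_compact) auto
  moreover have "continuous_on ?K (\<lambda>x. x \<bullet> (A *v x))"
    by (intro continuous_intros linear_continuous_on_compose[OF continuous_on_id]) auto
  ultimately obtain x where x: "x \<in> ?K" and max: "\<forall>y\<in>?K. y \<bullet> (A *v y) \<le> x \<bullet> (A *v x)"
    using continuous_attains_sup[of ?K "\<lambda>x. x \<bullet> (A *v x)"] by blast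
  define c where "c = x \<bullet> (A *v x)"
  have xx: "x \<bullet> x = 1" using x by (simp add: dot_square_norm)
  have q: "0 \<le> c * (y \<bullet> y) - y \<bullet> (A *v y)" if "y \<in> S" for y
  proof (cases "y = 0")
    case False
    let ?u = "y /\<^sub>R norm y"
    have "?u \<in> ?K" using that S False by (simp add: subspace_scale)
    then have "?u \<bullet> (A *v ?u) \<le> c" using max c_def by blast
    moreover have "?u \<bullet> (A *v ?u) = (y \<bullet> (A *v y)) / (y \<bullet> y)"
      by (simp add: matrix_vector_mult_scaleR dot_square_norm power2_eq_square field_simps)
    ultimately have "(y \<bullet> (A *v y)) / (y \<bullet> y) \<le> c" by simp
    then show ?thesis using False by (simp add: pos_divide_le_eq)
  qed simp
  \<comment> \<open>The residual of the eigenvalue equation. The nonnegative form in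
    \<open>q\<close> vanishes at \<open>x\<close>, and moving from \<open>x\<close> in direction
    \<open>w\<close> changes it with linear coefficient \<open>2 * (w \<bullet> w)\<close>.\<close>
  define w where "w = c *\<^sub>R x - A *v x"
  have w: "w \<in> S" using x S inv by (auto simp: w_def subspace_diff subspace_scale)
  have "0 \<le> 2 * t * (w \<bullet> w) + t\<^sup>2 * (c * (w \<bullet> w) - w \<bullet> (A *v w))" for t
  proof -
    have "0 \<le> c * ((x + t *\<^sub>R w) \<bullet> (x + t *\<^sub>R w)) - (x + t *\<^sub>R w) \<bullet> (A *v (x + t *\<^sub>R w))"
      using x w S by (intro q) (auto simp: subspace_add subspace_scale)
    also have "\<dots> = c * (x \<bullet> x) - x \<bullet> (A *v x) + 2 * t * (w \<bullet> (c *\<^sub>R x - A *v x))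
        + t\<^sup>2 * (c * (w \<bullet> w) - w \<bullet> (A *v w))"
      using symmetric_inner_swap[OF sym, of x w]
      by (simp add: inner_commute algebra_simps power2_eq_square)
    finally show ?thesis using xx by (simp add: c_def w_def)
  qed
  then have "w \<bullet> w = 0" by (rule linear_term_zero)
  then have "A *v x = c *\<^sub>R x" by (simp add: w_def)
  then show ?thesis using x by auto
qed

text \<open>An orthonormal family of eigenvectors of maximal size is a basis: otherwise its
  orthogonal complement is a nonzero invariant subspace and contributes one more.\<close>

lemma symmetric_orthogonal_diagonalization:
  fixes A :: "real^'n^'n"
  assumes sym: "transpose A = A"
  obtains Q d where "orthogonal_matrix Q" "A = Q ** diag d ** transpose Q"
proof -
  define P where "P B \<longleftrightarrow> pairwise orthogonal B \<and> (\<forall>x\<in>B. norm x = 1) \<and> (\<forall>x\<in>B. \<exists>c. A *v x = c *\<^sub>R x)"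
    for B :: "(real^'n) set"
  have bound: "finite B \<and> card B \<le> CARD('n)" if "P B" for B
  proof -
    have "0 \<notin> B" using that by (auto simp: P_def)
    then have ind: "independent B" using that by (auto simp: P_def pairwise_orthogonal_independent)
    show ?thesis
      using independent_bound[OF ind] by simp
  qed
  have P0: "P {}" by (simp add: P_def pairwise_def)
  obtain B where B: "P B" and Bmax: "\<And>B'. P B' \<Longrightarrow> card B' \<le> card B"
    using ex_has_greatest_nat[of P "{}" card "CARD('n) + 1"] P0 bound by (metis less_Suc_eq_le Suc_eq_plus1)
  have fin: "finite B" using bound B by blast
  have ind: "independent B"
    using B by (intro pairwise_orthogonal_independent) (auto simp: P_def)
  have card: "card B = CARD('n)"
  proof (rule ccontr)
    assume "card B \<noteq> CARD('n)"
    then have lt: "card B < CARD('n)" using bound[OF B] by linarith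
    define S where "S = {x. \<forall>b\<in>B. orthogonal b x}"
    have S: "subspace S" unfolding S_def by (rule subspace_orthogonal_to_vectors)
    have "span B \<noteq> UNIV" using lt ind
      by (metis dim_UNIV dim_eq_card_independent dim_span DIM_cart DIM_real mult.right_neutral nat_neq_iff)
    then obtain a where a: "a \<noteq> 0" "\<And>x. x \<in> span B \<Longrightarrow> orthogonal a x"
      using orthogonal_to_subspace_exists_gen[of B UNIV]
      by (metis span_UNIV subset_UNIV psubsetI)
    then have "a \<in> S" by (auto simp: S_def orthogonal_commute span_base)
    then have "S \<noteq> {0}" using a by auto
    have inv: "A *v x \<in> S" if "x \<in> S" for x
    proof -
      have "b \<bullet> (A *v x) = 0" if b: "b \<in> B" for b
      proof -
        obtain c where "A *v b = c *\<^sub>R b" using B b by (auto simp: P_def)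
        then show ?thesis using \<open>x \<in> S\<close> b symmetric_inner_swap[OF sym, of b x]
          by (simp add: S_def orthogonal_def)
      qed
      then show ?thesis by (simp add: S_def orthogonal_def)
    qed
    obtain x c where x: "x \<in> S" "norm x = 1" "A *v x = c *\<^sub>R x"
      using symmetric_eigenvector_exists[OF sym S \<open>S \<noteq> {0}\<close> inv] by blast
    have "x \<notin> B" using x by (auto simp: S_def orthogonal_def)
    moreover have "P (insert x B)"
      using B x by (auto simp: P_def pairwise_insert S_def orthogonal_commute)
    ultimately show False using Bmax[of "insert x B"] fin by simp
  qed
  obtain h where h: "bij_betw h (UNIV :: 'n set) B"
    using finite_same_card_bij[of "UNIV :: 'n set" B] fin card by auto
  have hB: "h i \<in> B" for i using h by (auto simp: bij_betw_def)
  have "\<forall>i. \<exists>c. A *v h i = c *\<^sub>R h i" using B hB by (simp add: P_def)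
  then obtain e where e: "\<And>i. A *v h i = e i *\<^sub>R h i" by metis
  define Q :: "real^'n^'n" where "Q = (\<chi> i j. h j $ i)"
  have "h i \<bullet> h j = (if i = j then 1 else 0)" for i j
  proof (cases "i = j")
    case True
    then show ?thesis using B hB by (simp add: P_def dot_square_norm)
  next
    case False
    then have "h i \<noteq> h j" using h by (auto simp: bij_betw_def inj_on_def)
    then show ?thesis using False B hB by (auto simp: P_def pairwise_def orthogonal_def)
  qed
  then have "transpose Q ** Q = mat 1"
    by (simp add: vec_eq_iff matrix_matrix_mult_def transpose_def Q_def mat_def inner_vec_def)
  then have Q: "orthogonal_matrix Q" by (simp add: orthogonal_matrix)
  have "(A ** Q) $ i $ j = (Q ** diag (\<chi> i. e i)) $ i $ j" for i j
  proof -
    have "(A ** Q) $ i $ j = (A *v h j) $ i"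
      by (simp add: matrix_matrix_mult_def matrix_vector_mult_def Q_def)
    also have "\<dots> = (Q ** diag (\<chi> i. e i)) $ i $ j"
      by (simp add: e mult_diag_nth Q_def)
    finally show ?thesis .
  qed
  then have "A ** Q = Q ** diag (\<chi> i. e i)" by (simp add: vec_eq_iff)
  then have "A = Q ** diag (\<chi> i. e i) ** transpose Q"
    using Q by (metis matrix_mul_assoc matrix_mul_rid orthogonal_matrix_def)
  with Q show ?thesis using that by blast
qed

section \<open>Spectral calculus\<close>

lemma matrix_inv_eq:
  fixes A B :: "real^'n^'n"
  assumes "A ** B = mat 1"
  shows "matrix_inv A = B"
proof -
  have BA: "B ** A = mat 1" using assms matrix_left_right_inverse by blast
  have "A ** matrix_inv A = mat 1 \<and> matrix_inv A ** A = mat 1"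
    unfolding matrix_inv_def by (rule someI[where x=B]) (use assms BA in simp)
  then have "B ** (A ** matrix_inv A) = B" by simp
  then show ?thesis by (simp add: matrix_mul_assoc BA)
qed

lemma matrix_mul_cancel:
  fixes X :: "real^'n^'m" and A B :: "real^'n^'n"
  assumes "A ** B = mat 1"
  shows "X ** A ** B = X"
  using assms by (simp flip: matrix_mul_assoc)

lemma transpose_diag [simp]: "transpose (diag d) = diag d"
  by (auto simp: vec_eq_iff transpose_def diag_def)

lemma diag_mult_diag: "diag a ** diag b = diag (\<chi> i. a $ i * b $ i)"
  by (simp add: vec_eq_iff diag_mult_nth) (simp add: diag_def)

lemma diag_1: "diag (\<chi> i. 1) = mat 1"
  by (simp add: diag_def mat_def vec_eq_iff)

lemma det_diag: "det (diag d) = (\<Prod>i\<in>UNIV. d $ i)"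
  by (subst det_diagonal) (auto simp: diag_def)

text \<open>\<open>Q\<close> is allowed to be any matrix: an invertible \<open>Q\<close> shared by two matrices diagonalises them
  simultaneously by congruence.\<close>

definition spec :: "real^'n^'n \<Rightarrow> real^'n \<Rightarrow> real^'n^'n" where
  "spec Q d = Q ** diag d ** transpose Q"

text \<open>Storing the logarithms of the eigenvalues turns matrix powers into scaling and products
  in one eigenbasis into addition.\<close>

definition vexp :: "real^'n \<Rightarrow> real^'n" where
  "vexp l = (\<chi> i. exp (l $ i))"

lemma vexp_nth [simp]: "vexp l $ i = exp (l $ i)"
  by (simp add: vexp_def)

lemma orthogonal_matrix_cancel:
  fixes Q :: "real^'n^'n"
  assumes "orthogonal_matrix Q"
  shows "transpose Q ** Q = mat 1" "Q ** transpose Q = mat 1"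
    "X ** transpose Q ** Q = X" "X ** Q ** transpose Q = X"
  using assms by (auto simp: orthogonal_matrix_def matrix_mul_cancel)

lemma sym_fun_spec:
  "orthogonal_matrix Q \<Longrightarrow> sym_fun f (spec Q d) = spec Q (\<chi> i. f (d $ i))"
  by (simp add: spec_def sym_fun_eq)

lemma log_m_spec: "orthogonal_matrix Q \<Longrightarrow> log_m (spec Q (vexp l)) = spec Q l"
  by (simp add: log_m_def sym_fun_spec)

lemma mpow_spec: "orthogonal_matrix Q \<Longrightarrow> mpow (spec Q (vexp l)) t = spec Q (vexp (t *\<^sub>R l))"
  by (simp add: mpow_def sym_fun_spec vexp_def powr_def)

lemma transpose_spec [simp]: "transpose (spec Q d) = spec Q d"
  by (simp add: spec_def matrix_transpose_mul matrix_mul_assoc)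

lemma spec_mult:
  "orthogonal_matrix Q \<Longrightarrow> spec Q a ** spec Q b = spec Q (\<chi> i. a $ i * b $ i)"
  by (simp add: spec_def matrix_mul_assoc orthogonal_matrix_cancel flip: diag_mult_diag)

lemma spec_vexp_mult:
  "orthogonal_matrix Q \<Longrightarrow> spec Q (vexp a) ** spec Q (vexp b) = spec Q (vexp (a + b))"
  by (simp add: spec_mult vexp_def exp_add)

lemma spec_vexp_0: "orthogonal_matrix Q \<Longrightarrow> spec Q (vexp 0) = mat 1"
  by (simp add: spec_def vexp_def diag_1 orthogonal_matrix_cancel)

lemma matrix_inv_spec: "orthogonal_matrix Q \<Longrightarrow> matrix_inv (spec Q (vexp l)) = spec Q (vexp (- l))"
  by (rule matrix_inv_eq) (simp add: spec_vexp_mult spec_vexp_0)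

lemma det_spec:
  assumes "orthogonal_matrix Q"
  shows "det (spec Q (vexp l)) = exp (\<Sum>i\<in>UNIV. l $ i)"
proof -
  have "det (spec Q (vexp l)) = det (diag (vexp l)) * (det Q * det (transpose Q))"
    by (simp add: spec_def det_mul)
  also have "det Q * det (transpose Q) = 1"
    using assms by (metis det_I det_mul orthogonal_matrix_def)
  finally show ?thesis by (simp add: det_diag exp_sum)
qed

lemma congruence_inner:
  fixes A F :: "real^'n^'n"
  shows "x \<bullet> ((F ** A ** transpose F) *v x) = (transpose F *v x) \<bullet> (A *v (transpose F *v x))"
proof -
  have "(F ** A ** transpose F) *v x = F *v (A *v (transpose F *v x))"
    by (simp only: matrix_vector_mul_assoc matrix_mul_assoc)
  then show ?thesis by (simp add: dot_lmul_matrix)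
qed

lemma spec_in_SPD:
  assumes Q: "orthogonal_matrix Q"
  shows "spec Q (vexp l) \<in> SPD"
proof -
  have "x \<bullet> (spec Q (vexp l) *v x) > 0" if "x \<noteq> 0" for x
  proof -
    define y where "y = transpose Q *v x"
    have "Q *v y = (Q ** transpose Q) *v x" by (simp only: y_def matrix_vector_mul_assoc)
    also have "\<dots> = x" by (simp add: orthogonal_matrix_cancel[OF Q])
    finally have "Q *v y = x" .
    then have "y \<noteq> 0" using that by auto
    then obtain i where i: "y $ i \<noteq> 0" by (auto simp: vec_eq_iff)
    have "(diag (vexp l) *v y) $ i = exp (l $ i) * y $ i" for i
    proof -
      have "(diag (vexp l) *v y) $ i = (\<Sum>k\<in>UNIV. if i = k then exp (l $ i) * y $ k else 0)"
        unfolding matrix_vector_mult_def diag_def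
        by (simp only: vec_lambda_beta) (rule sum.cong; simp)
      then show ?thesis by simp
    qed
    then have "y \<bullet> (diag (vexp l) *v y) = (\<Sum>i\<in>UNIV. exp (l $ i) * (y $ i)\<^sup>2)"
      by (simp add: inner_vec_def power2_eq_square mult_ac)
    also have "\<dots> > 0" using i by (intro sum_pos2[where i=i]) auto
    finally have "y \<bullet> (diag (vexp l) *v y) > 0" .
    moreover have "x \<bullet> (spec Q (vexp l) *v x) = y \<bullet> (diag (vexp l) *v y)"
      by (simp only: spec_def y_def congruence_inner)
    ultimately show ?thesis by simp
  qed
  then show ?thesis by (simp add: SPD_def)
qed

lemma SPD_spec_cases:
  assumes "A \<in> SPD"
  obtains Q l where "orthogonal_matrix Q" "A = spec Q (vexp l)"
proof -
  obtain Q d where Q: "orthogonal_matrix Q" and A: "A = spec Q d"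
    using symmetric_orthogonal_diagonalization[of A] assms by (auto simp: SPD_def spec_def)
  have "d $ i > 0" for i
  proof -
    let ?x = "Q *v axis i 1"
    have tx: "transpose Q *v ?x = axis i 1"
      using Q by (simp add: matrix_vector_mul_assoc orthogonal_matrix_cancel)
    then have "?x \<noteq> 0" by (metis axis_eq_0_iff matrix_vector_mult_0_right zero_neq_one)
    then have "?x \<bullet> (A *v ?x) > 0" using assms by (auto simp: SPD_def)
    also have "A *v ?x = Q *v (diag d *v axis i 1)"
      unfolding A spec_def using tx by (simp flip: matrix_vector_mul_assoc)
    also have "?x \<bullet> \<dots> = (transpose Q *v ?x) \<bullet> (diag d *v axis i 1)"
      by (metis dot_lmul_matrix vector_transpose_matrix transpose_transpose)
    also have "\<dots> = d $ i"
      unfolding tx by (simp add: inner_axis' matrix_vector_mult_basis column_def diag_def)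
    finally show ?thesis .
  qed
  then have "d = vexp (\<chi> i. ln (d $ i))" by (simp add: vec_eq_iff)
  then show ?thesis using that Q A by metis
qed

lemma congruence_in_SPD:
  fixes A F :: "real^'n^'n"
  assumes A: "A \<in> SPD" and F: "invertible F"
  shows "F ** A ** transpose F \<in> SPD"
proof -
  have "x \<bullet> ((F ** A ** transpose F) *v x) > 0" if "x \<noteq> 0" for x
  proof -
    have "transpose F *v x \<noteq> 0"
      using that transpose_invertible[OF F] by (metis invertible_left_inverse matrix_left_invertible_ker)
    then have "(transpose F *v x) \<bullet> (A *v (transpose F *v x)) > 0"
      using A by (auto simp: SPD_def)
    then show ?thesis by (simp only: congruence_inner)
  qed
  then show ?thesis using A by (simp add: SPD_def matrix_transpose_mul matrix_mul_assoc)
qed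

section \<open>Overlap weights of two eigenbases\<close>

definition overlap :: "real^'n^'n \<Rightarrow> real^'n^'n \<Rightarrow> 'n \<Rightarrow> 'n \<Rightarrow> real" where
  "overlap P Q i j = ((transpose P ** Q) $ i $ j)\<^sup>2"

lemma overlap_nonneg: "overlap P Q i j \<ge> 0"
  by (simp add: overlap_def)

lemma overlap_commute: "overlap P Q i j = overlap Q P j i"
proof -
  have "transpose P ** Q = transpose (transpose Q ** P)" by (simp add: matrix_transpose_mul)
  then show ?thesis by (simp add: overlap_def transpose_def)
qed

lemma sum_square_orthogonal_row:
  fixes W :: "real^'n^'n"
  assumes "W ** transpose W = mat 1"
  shows "(\<Sum>j\<in>UNIV. (W $ i $ j)\<^sup>2) = 1"
proof -
  have "(W ** transpose W) $ i $ i = 1" using assms by (simp add: mat_def)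
  then show ?thesis by (simp add: matrix_matrix_mult_def transpose_def power2_eq_square)
qed

lemma overlap_sums:
  assumes "orthogonal_matrix P" "orthogonal_matrix Q"
  shows "(\<Sum>j\<in>UNIV. overlap P Q i j) = 1" "(\<Sum>i\<in>UNIV. overlap P Q i j) = 1"
proof -
  let ?W = "transpose P ** Q"
  have "?W ** transpose ?W = mat 1" "transpose ?W ** transpose (transpose ?W) = mat 1"
    using assms by (simp_all add: matrix_transpose_mul matrix_mul_assoc orthogonal_matrix_cancel)
  from this[THEN sum_square_orthogonal_row]
  show "(\<Sum>j\<in>UNIV. overlap P Q i j) = 1" "(\<Sum>i\<in>UNIV. overlap P Q i j) = 1"
    by (simp_all add: overlap_def transpose_def)
qed

lemma trace_spec_mult:
  "trace (spec P a ** spec Q b) = (\<Sum>i\<in>UNIV. \<Sum>j\<in>UNIV. overlap P Q i j * (a $ i * b $ j))"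
proof -
  let ?W = "transpose P ** Q"
  have "trace (spec P a ** spec Q b) = trace (P ** (diag a ** ?W ** diag b ** transpose Q))"
    by (simp add: spec_def matrix_mul_assoc)
  also have "\<dots> = trace ((diag a ** ?W) ** (diag b ** transpose ?W))"
    by (subst trace_mul_sym) (simp add: matrix_transpose_mul matrix_mul_assoc)
  also have "\<dots> = (\<Sum>i\<in>UNIV. \<Sum>j\<in>UNIV. (diag a ** ?W) $ i $ j * (diag b ** transpose ?W) $ j $ i)"
    by (simp add: trace_def matrix_matrix_mult_def)
  also have "\<dots> = (\<Sum>i\<in>UNIV. \<Sum>j\<in>UNIV. overlap P Q i j * (a $ i * b $ j))"
    unfolding diag_mult_nth by (simp add: overlap_def power2_eq_square mult_ac transpose_def)
  finally show ?thesis .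
qed

lemma trace_spec: "orthogonal_matrix Q \<Longrightarrow> trace (spec Q d) = (\<Sum>i\<in>UNIV. d $ i)"
  unfolding spec_def
  by (subst trace_mul_sym) (simp add: matrix_mul_assoc orthogonal_matrix_cancel, simp add: trace_def diag_def)

lemma norm_symmetric_square:
  fixes A :: "real^'n^'n"
  assumes "transpose A = A"
  shows "(norm A)\<^sup>2 = trace (A ** A)"
proof -
  have "A $ j $ i = A $ i $ j" for i j using assms by (metis transpose_def vec_lambda_beta)
  then show ?thesis
    by (simp add: power2_norm_eq_inner inner_vec_def trace_def matrix_matrix_mult_def)
qed

lemma norm_vec_square: "(norm (d :: real^'n))\<^sup>2 = (\<Sum>i\<in>UNIV. (d $ i)\<^sup>2)"
  by (simp add: power2_norm_eq_inner inner_vec_def) (simp add: power2_eq_square)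

lemma norm_spec:
  assumes "orthogonal_matrix Q"
  shows "norm (spec Q d) = norm d"
proof -
  have "(norm (spec Q d))\<^sup>2 = (norm d)\<^sup>2"
    using assms
    by (simp add: norm_symmetric_square spec_mult trace_spec norm_vec_square[of d])
      (simp add: power2_eq_square)
  then show ?thesis by simp
qed

text \<open>The weights are doubly stochastic, so an expression in one spectrum only can be written
  as a double sum and merged term by term with mixed expressions.\<close>

lemma sum_overlap_left:
  assumes "orthogonal_matrix P" "orthogonal_matrix Q"
  shows "(\<Sum>i\<in>UNIV. \<Sum>j\<in>UNIV. overlap P Q i j * f i) = (\<Sum>i\<in>UNIV. f i)"
  by (simp add: overlap_sums[OF assms] flip: sum_distrib_right)

lemma sum_overlap_right:
  assumes "orthogonal_matrix P" "orthogonal_matrix Q"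
  shows "(\<Sum>i\<in>UNIV. \<Sum>j\<in>UNIV. overlap P Q i j * f j) = (\<Sum>j\<in>UNIV. f j)"
  by (subst sum.swap) (simp add: overlap_sums[OF assms] flip: sum_distrib_right)

lemma inner_spec: "spec P a \<bullet> spec Q b = (\<Sum>i\<in>UNIV. \<Sum>j\<in>UNIV. overlap P Q i j * (a $ i * b $ j))"
proof -
  have "spec Q b $ j $ i = spec Q b $ i $ j" for i j
  proof -
    have "transpose (spec Q b) $ i $ j = spec Q b $ i $ j" by (simp only: transpose_spec)
    then show ?thesis by (simp add: transpose_def del: transpose_spec)
  qed
  then have "spec P a \<bullet> spec Q b = trace (spec P a ** spec Q b)"
    by (simp add: inner_vec_def trace_def matrix_matrix_mult_def)
  then show ?thesis by (simp add: trace_spec_mult)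
qed

lemma norm_spec_diff:
  assumes P: "orthogonal_matrix P" and Q: "orthogonal_matrix Q"
  shows "(norm (spec P a - spec Q b))\<^sup>2 =
    (\<Sum>i\<in>UNIV. \<Sum>j\<in>UNIV. overlap P Q i j * (a $ i - b $ j)\<^sup>2)"
proof -
  have "(norm (spec P a - spec Q b))\<^sup>2 = (norm a)\<^sup>2 - 2 * (spec P a \<bullet> spec Q b) + (norm b)\<^sup>2"
    using dot_norm_neg[of "spec P a" "spec Q b"] by (simp add: norm_spec P Q)
  also have "(norm a)\<^sup>2 = (\<Sum>i\<in>UNIV. \<Sum>j\<in>UNIV. overlap P Q i j * (a $ i)\<^sup>2)"
    by (simp add: sum_overlap_left[OF P Q] norm_vec_square)
  also have "(norm b)\<^sup>2 = (\<Sum>i\<in>UNIV. \<Sum>j\<in>UNIV. overlap P Q i j * (b $ j)\<^sup>2)"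
    by (simp add: sum_overlap_right[OF P Q] norm_vec_square)
  finally show ?thesis
    by (simp add: inner_spec power2_diff algebra_simps sum.distrib sum_subtractf sum_distrib_left)
qed

section \<open>The natural distance\<close>

text \<open>The right-hand side is 4 sinh^2 (x/2), and |u| <= |sinh u|.\<close>

lemma square_le_cosh: "x\<^sup>2 \<le> 2 * cosh x - (2::real)"
proof -
  have pos: "u \<le> sinh u" if "u \<ge> 0" for u :: real
  proof -
    have "sinh 0 - 0 \<le> sinh u - u"
    proof (rule DERIV_nonneg_imp_nondecreasing[OF that])
      fix x :: real
      show "\<exists>y. ((\<lambda>u. sinh u - u) has_real_derivative y) (at x) \<and> 0 \<le> y"
        by (intro exI[of _ "cosh x - 1"] conjI) (auto intro!: derivative_eq_intros simp: cosh_real_ge_1)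
    qed
    then show ?thesis by simp
  qed
  have "\<bar>x / 2\<bar> \<le> \<bar>sinh (x / 2)\<bar>"
    using pos[of "x / 2"] pos[of "- x / 2"] by (cases "x \<ge> 0") auto
  then have "(x / 2)\<^sup>2 \<le> (sinh (x / 2))\<^sup>2" by (simp only: abs_le_square_iff)
  also have "2 * (sinh (x / 2))\<^sup>2 = cosh (2 * (x / 2)) - 1"
    unfolding cosh_double using cosh_square_eq[of "x / 2"] by simp
  finally show ?thesis by (simp add: power2_eq_square)
qed

section \<open>Matrix powers and whitening\<close>

lemma mpow_in_SPD: "A \<in> SPD \<Longrightarrow> mpow A t \<in> SPD"
  by (metis SPD_spec_cases mpow_spec spec_in_SPD)

lemma transpose_SPD: "A \<in> SPD \<Longrightarrow> transpose A = A"
  by (simp add: SPD_def)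

lemma mpow_add:
  assumes "A \<in> SPD" shows "mpow A s ** mpow A t = mpow A (s + t)"
proof -
  from assms obtain Q l where "orthogonal_matrix Q" "A = spec Q (vexp l)" by (rule SPD_spec_cases)
  then show ?thesis by (simp add: mpow_spec spec_vexp_mult scaleR_add_left)
qed

lemma mpow_0: "A \<in> SPD \<Longrightarrow> mpow A 0 = mat 1"
  by (metis SPD_spec_cases mpow_spec scaleR_zero_left spec_vexp_0)

lemma mpow_1: "A \<in> SPD \<Longrightarrow> mpow A 1 = A"
  by (metis SPD_spec_cases mpow_spec scaleR_one)

lemma mpow_inverse: "A \<in> SPD \<Longrightarrow> mpow A t ** mpow A (- t) = mat 1"
  by (simp add: mpow_add mpow_0)

lemma invertible_mpow: "A \<in> SPD \<Longrightarrow> invertible (mpow A t)"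
  using mpow_inverse invertible_right_inverse by blast

lemma whiten_in_SPD:
  assumes "A \<in> SPD" "B \<in> SPD" shows "whiten A B \<in> SPD"
  using congruence_in_SPD[OF assms(2) invertible_mpow[OF assms(1), of "- 1/2"]]
  by (simp add: whiten_def transpose_SPD mpow_in_SPD assms)

lemma unwhiten:
  assumes A: "A \<in> SPD"
  shows "mpow A (1/2) ** whiten A B ** mpow A (1/2) = B"
proof -
  have "mpow A (1/2) ** mpow A (-1/2) = mat 1" "mpow A (-1/2) ** mpow A (1/2) = mat 1"
    using mpow_inverse[OF A, of "1/2"] mpow_inverse[OF A, of "-1/2"] by auto
  then show ?thesis by (simp add: whiten_def matrix_mul_assoc matrix_mul_cancel)
qed

section \<open>Simultaneous diagonalisation by congruence\<close>

lemma invertible_diag_vexp: "invertible (diag (vexp a))"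
proof -
  have "diag (vexp a) ** diag (vexp (- a)) = mat 1"
    by (simp add: diag_mult_diag flip: diag_1 exp_add)
  then show ?thesis using invertible_right_inverse by blast
qed

lemma spec_vexp_shift: "spec (F ** diag (vexp c)) (vexp a) = spec F (vexp (a + 2 *\<^sub>R c))"
proof -
  have "spec (F ** diag (vexp c)) (vexp a) = F ** (diag (vexp c) ** diag (vexp a) ** diag (vexp c)) ** transpose F"
    by (simp add: spec_def matrix_transpose_mul matrix_mul_assoc)
  also have "diag (vexp c) ** diag (vexp a) ** diag (vexp c) = diag (vexp (a + 2 *\<^sub>R c))"
    by (simp add: diag_mult_diag vexp_def flip: exp_add) (simp add: algebra_simps)
  finally show ?thesis by (simp add: spec_def)
qed

lemma spec_congruence: "F ** spec G d ** transpose F = spec (F ** G) d"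
  by (simp add: spec_def matrix_transpose_mul matrix_mul_assoc)

lemma spec_vexp_0_eq: "spec F (vexp 0) = F ** transpose F"
  by (simp add: spec_def vexp_def diag_1)

lemma spec_invertible_in_SPD:
  assumes "invertible F" shows "spec F (vexp a) \<in> SPD"
proof -
  have "spec (mat 1) (vexp a) \<in> SPD" by (intro spec_in_SPD) (simp add: orthogonal_matrix)
  from congruence_in_SPD[OF this assms] show ?thesis by (simp add: spec_congruence)
qed

text \<open>Here \<open>A\<close> is \<open>F ** transpose F\<close>, so multiplying
  \<open>F\<close> by the inverse square root of \<open>A\<close> gives an orthogonal matrix, which
  diagonalises the whitened second argument.\<close>

lemma nat_dist_spec_0:
  assumes F: "invertible F"
  shows "nat_dist (spec F (vexp 0)) (spec F (vexp m)) = norm m"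
proof -
  define A where "A = spec F (vexp 0)"
  define R where "R = mpow A (- 1/2)"
  have A: "A \<in> SPD" unfolding A_def by (rule spec_invertible_in_SPD[OF F])
  have R: "transpose R = R" using A by (simp add: R_def transpose_SPD mpow_in_SPD)
  have "R ** A ** R = R ** mpow A 1 ** R" using A by (simp add: mpow_1)
  also have "\<dots> = mat 1" using A by (simp add: R_def mpow_add mpow_0)
  finally have "(R ** F) ** transpose (R ** F) = mat 1"
    by (simp add: A_def spec_vexp_0_eq matrix_transpose_mul R matrix_mul_assoc)
  then have O: "orthogonal_matrix (R ** F)"
    by (metis orthogonal_matrix_def matrix_left_right_inverse)
  have "whiten A (spec F (vexp m)) = R ** spec F (vexp m) ** transpose R"
    by (simp add: whiten_def R) (simp add: R_def)
  also have "\<dots> = spec (R ** F) (vexp m)" by (rule spec_congruence)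
  finally have "whiten A (spec F (vexp m)) = spec (R ** F) (vexp m)" .
  then show ?thesis using O by (simp add: nat_dist_def log_m_spec norm_spec flip: A_def)
qed

lemma nat_dist_spec:
  assumes F: "invertible F"
  shows "nat_dist (spec F (vexp a)) (spec F (vexp b)) = norm (a - b)"
proof -
  \<comment> \<open>Rescaling the frame moves the first argument to logarithm 0. The factor 1/2
    appears because the frame acts on both sides.\<close>
  let ?G = "F ** diag (vexp ((1/2) *\<^sub>R a))"
  have "invertible ?G" using F invertible_diag_vexp invertible_mult by blast
  from nat_dist_spec_0[OF this, of "b - a"] show ?thesis
    by (simp add: spec_vexp_shift norm_minus_commute)
qed

text \<open>The frame is the square root of \<open>A\<close> times an orthogonal matrix that
  diagonalises the whitened \<open>B\<close>.\<close>

lemma simultaneous_spec: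
  assumes A: "A \<in> SPD" and B: "B \<in> SPD"
  obtains F m where "invertible F" "A = spec F (vexp 0)" "B = spec F (vexp m)"
proof -
  obtain Q m where Q: "orthogonal_matrix Q" and m: "whiten A B = spec Q (vexp m)"
    using SPD_spec_cases whiten_in_SPD[OF A B] by metis
  define H where "H = mpow A (1/2)"
  have H: "transpose H = H" using A by (simp add: H_def transpose_SPD mpow_in_SPD)
  have "invertible Q" using Q by (metis orthogonal_matrix_def invertible_def)
  then have "invertible (H ** Q)" using invertible_mpow[OF A] by (simp add: H_def invertible_mult)
  moreover have "A = spec (H ** Q) (vexp 0)"
  proof -
    have "spec (H ** Q) (vexp 0) = H ** H"
      using Q H by (simp add: spec_vexp_0_eq matrix_transpose_mul matrix_mul_assoc orthogonal_matrix_cancel)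
    then show ?thesis using A by (simp add: H_def mpow_add mpow_1)
  qed
  moreover have "B = spec (H ** Q) (vexp m)"
    using unwhiten[OF A, of B] H m by (simp add: spec_congruence[of H, unfolded H] flip: H_def)
  ultimately show ?thesis using that by blast
qed

lemma nat_dist_congruence:
  fixes A B F :: "real^'n^'n"
  assumes "A \<in> SPD" "B \<in> SPD" and F: "invertible F"
  shows "nat_dist (F ** A ** transpose F) (F ** B ** transpose F) = nat_dist A B"
proof -
  from assms(1,2) obtain G m where "invertible G" "A = spec G (vexp 0)" "B = spec G (vexp m)"
    by (rule simultaneous_spec)
  then show ?thesis by (simp add: spec_congruence nat_dist_spec F invertible_mult)
qed

text \<open>Twice the symmetrised Kullback--Leibler divergence. It is explicit both for simultaneously
  diagonalised matrices and in terms of two spectral decompositions, which makes it the link between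
  the natural distance and the Euclidean distance of logarithms.\<close>

definition sym_KL :: "real^'n^'n \<Rightarrow> real^'n^'n \<Rightarrow> real" where
  "sym_KL A B = trace (matrix_inv A ** B) + trace (matrix_inv B ** A) - 2 * real CARD('n)"

text \<open>The inverse matrices are diagonal in the dual frame. Its overlap with \<open>F\<close>
  is the identity, so only the diagonal terms of the trace formula survive.\<close>

lemma sym_KL_spec:
  fixes F :: "real^'n^'n"
  assumes F: "invertible F"
  shows "sym_KL (spec F (vexp a)) (spec F (vexp b)) = (\<Sum>i\<in>UNIV. 2 * cosh (a $ i - b $ i) - 2)"
proof -
  obtain G where FG: "F ** G = mat 1" and GF: "G ** F = mat 1" using F by (auto simp: invertible_def)
  have TGF: "transpose F ** transpose G = mat 1"
    using GF by (metis matrix_transpose_mul transpose_mat)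
  have inv: "matrix_inv (spec F (vexp c)) = spec (transpose G) (vexp (- c))" for c
  proof (rule matrix_inv_eq)
    have "diag (vexp c) ** diag (vexp (- c)) = mat 1"
      by (simp add: diag_mult_diag flip: diag_1 exp_add)
    then show "spec F (vexp c) ** spec (transpose G) (vexp (- c)) = mat 1"
      by (simp add: spec_def matrix_mul_assoc matrix_mul_cancel TGF FG)
  qed
  have ov: "overlap (transpose G) F i j = (if i = j then 1 else 0)" for i j
    by (simp add: overlap_def GF mat_def)
  have "trace (matrix_inv (spec F (vexp c)) ** spec F (vexp d)) = (\<Sum>i\<in>UNIV. exp (d $ i - c $ i))" for c d
  proof -
    have "trace (matrix_inv (spec F (vexp c)) ** spec F (vexp d)) =
       (\<Sum>i\<in>UNIV. \<Sum>j\<in>UNIV. if i = j then exp (- c $ i) * exp (d $ i) else 0)"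
      unfolding inv trace_spec_mult ov by (intro sum.cong) auto
    then show ?thesis by (simp add: exp_minus exp_diff field_simps)
  qed
  moreover have "2 * cosh x - 2 = exp x + exp (- x) - 2" for x :: real by (simp add: cosh_def)
  ultimately show ?thesis by (simp add: sym_KL_def sum.distrib sum_subtractf)
qed

lemma sym_KL_orthogonal:
  fixes P Q :: "real^'n^'n"
  assumes P: "orthogonal_matrix P" and Q: "orthogonal_matrix Q"
  shows "sym_KL (spec P (vexp a)) (spec Q (vexp b)) =
    (\<Sum>i\<in>UNIV. \<Sum>j\<in>UNIV. overlap P Q i j * (2 * cosh (a $ i - b $ j) - 2))"
proof -
  have "trace (spec Q (vexp (- b)) ** spec P (vexp a)) = trace (spec P (vexp a) ** spec Q (vexp (- b)))"
    by (rule trace_mul_sym)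
  moreover have "2 * real CARD('n) = (\<Sum>i\<in>UNIV. \<Sum>j\<in>UNIV. overlap P Q i j * 2)"
    by (simp add: sum_overlap_left[OF P Q, of "\<lambda>_. 2"])
  moreover have "2 * cosh (a $ i - b $ j) - 2 =
      exp (- a $ i) * exp (b $ j) + exp (a $ i) * exp (- b $ j) - 2" for i j
    by (simp add: cosh_def flip: exp_add)
  ultimately show ?thesis
    by (simp add: sym_KL_def matrix_inv_spec P Q trace_spec_mult distrib_left right_diff_distrib
        sum.distrib sum_subtractf)
qed

lemma nat_dist_le_sym_KL:
  assumes "A \<in> SPD" "B \<in> SPD"
  shows "(nat_dist A B)\<^sup>2 \<le> sym_KL A B"
proof -
  from assms obtain F m where "invertible F" "A = spec F (vexp 0)" "B = spec F (vexp m)"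
    by (rule simultaneous_spec)
  then show ?thesis
    by (auto simp: nat_dist_spec sym_KL_spec norm_vec_square intro!: sum_mono square_le_cosh)
qed

lemma log_m_diff_le_sym_KL:
  assumes "A \<in> SPD" "B \<in> SPD"
  shows "(norm (log_m A - log_m B))\<^sup>2 \<le> sym_KL A B"
proof -
  obtain P a Q b where "orthogonal_matrix P" "A = spec P (vexp a)" "orthogonal_matrix Q" "B = spec Q (vexp b)"
    using assms SPD_spec_cases by metis
  then show ?thesis
    by (auto simp: log_m_spec norm_spec_diff sym_KL_orthogonal
        intro!: sum_mono mult_left_mono square_le_cosh overlap_nonneg)
qed

text \<open>The exponential metric increasing property. The preceding bound is sharp to second order, so
  it is applied to the pieces of a fine subdivision of the geodesic from \<open>A\<close> to \<open>B\<close>.\<close>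

lemma log_m_diff_le_nat_dist:
  fixes A B :: "real^'n^'n"
  assumes "A \<in> SPD" "B \<in> SPD"
  shows "norm (log_m A - log_m B) \<le> nat_dist A B"
proof -
  from assms obtain F m where F: "invertible F" and A: "A = spec F (vexp 0)" and B: "B = spec F (vexp m)"
    by (rule simultaneous_spec)
  \<comment> \<open>\<open>c s\<close> is the \<open>sym_KL\<close> of two points of the geodesic
    whose parameters differ by \<open>1 / s\<close>; it does not depend on their position.\<close>
  define c where "c s = (\<Sum>i\<in>UNIV. 2 * cosh (m $ i / s) - 2)" for s :: real
  define g where "g r = log_m (spec F (vexp (r *\<^sub>R m)))" for r
  have step: "norm (g r - g (r + 1 / s)) \<le> sqrt (c s)" for r s
  proof (rule real_le_rsqrt)
    have "(norm (g r - g (r + 1 / s)))\<^sup>2 \<le> sym_KL (spec F (vexp (r *\<^sub>R m))) (spec F (vexp ((r + 1 / s) *\<^sub>R m)))"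
      unfolding g_def using F by (intro log_m_diff_le_sym_KL spec_invertible_in_SPD)
    also have "\<dots> = c s"
      unfolding c_def sym_KL_spec[OF F] by (simp add: algebra_simps)
    finally show "(norm (g r - g (r + 1 / s)))\<^sup>2 \<le> c s" .
  qed
  have tele: "norm (g 0 - g (real k / s)) \<le> real k * sqrt (c s)" for k s
  proof (induction k)
    case (Suc k)
    have "norm (g 0 - g (real (Suc k) / s)) \<le>
        norm (g 0 - g (real k / s)) + norm (g (real k / s) - g (real k / s + 1 / s))"
      using norm_triangle_ineq[of "g 0 - g (real k / s)" "g (real k / s) - g (real k / s + 1 / s)"]
      by (simp add: add_divide_distrib add.commute)
    also have "\<dots> \<le> real k * sqrt (c s) + sqrt (c s)" using Suc step by (intro add_mono)
    finally show ?case by (simp add: algebra_simps)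
  qed simp
  have "norm (g 0 - g 1) \<le> sqrt (\<Sum>i\<in>UNIV. (real N)\<^sup>2 * (2 * cosh (m $ i / real N) - 2))" if "N > 0" for N
    using tele[of N "real N"] that by (simp add: c_def real_sqrt_mult flip: sum_distrib_left)
  \<comment> \<open>\<open>N\<close> steps cost \<open>N * sqrt (c N)\<close> in total, and the
    second-order sharpness of the cosh bound makes this tend to the length of the geodesic.\<close>
  moreover have "(\<lambda>N. sqrt (\<Sum>i\<in>UNIV. (real N)\<^sup>2 * (2 * cosh (m $ i / real N) - 2)))
      \<longlonglongrightarrow> sqrt (\<Sum>i\<in>UNIV. m $ i * m $ i)"
    by (intro tendsto_real_sqrt tendsto_sum) real_asymp
  ultimately have "norm (g 0 - g 1) \<le> sqrt (\<Sum>i\<in>UNIV. m $ i * m $ i)"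
    by (intro LIMSEQ_le_const) (auto intro!: exI[of _ 1])
  also have "\<dots> = norm m" by (simp add: norm_eq_sqrt_inner inner_vec_def)
  finally show ?thesis using F by (simp add: g_def A B nat_dist_spec)
qed

text \<open>Whitening by \<open>A\<close> sends \<open>A\<close> to the identity. Distances from the
  identity are exactly norms of logarithms, and the third side dominates the norm of their
  difference.\<close>

lemma nat_dist_triangle:
  assumes A: "A \<in> SPD" and B: "B \<in> SPD" and C: "C \<in> SPD"
  shows "nat_dist A C \<le> nat_dist A B + nat_dist B C"
proof -
  define R where "R = mpow A (- 1/2)"
  have R: "transpose R = R" "invertible R" using A by (auto simp: R_def transpose_SPD mpow_in_SPD invertible_mpow)
  have "nat_dist B C = nat_dist (R ** B ** transpose R) (R ** C ** transpose R)"
    by (rule nat_dist_congruence[symmetric, OF B C R(2)])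
  also have "\<dots> = nat_dist (whiten A B) (whiten A C)" by (simp add: whiten_def R(1)) (simp add: R_def)
  also have "\<dots> \<ge> norm (log_m (whiten A B) - log_m (whiten A C))"
    using A B C by (intro log_m_diff_le_nat_dist whiten_in_SPD)
  finally show ?thesis unfolding nat_dist_def
    using norm_triangle_ineq2[of "log_m (whiten A C)" "log_m (whiten A B)"] by (simp add: norm_minus_commute)
qed

section \<open>The scalar minimisation problem\<close>

lemma exp_tangent_le: "exp y * (x - y) \<le> exp x - exp (y::real)"
proof -
  have "exp y * (1 + (x - y)) \<le> exp y * exp (x - y)"
    by (intro mult_left_mono exp_ge_add_one_self) auto
  then show ?thesis by (simp add: algebra_simps exp_diff)
qed

lemma exp_tangent_less:
  assumes "x \<noteq> (y::real)" shows "exp y * (x - y) < exp x - exp y"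
proof -
  have "1 + (x - y) \<noteq> exp (x - y)"
    using ln_eq_minus_one[of "exp (x - y)"] assms by auto
  then have "1 + (x - y) < exp (x - y)"
    using exp_ge_add_one_self[of "x - y"] by linarith
  then have "exp y * (1 + (x - y)) < exp y * exp (x - y)" by simp
  then show ?thesis by (simp add: algebra_simps exp_diff)
qed

text \<open>Caratheodory's form of the derivative at 0: a factor that is continuous there and can be
  evaluated at 0. Its positivity later keeps a denominator away from zero.\<close>

lemma exp_divided_difference:
  obtains E :: "real \<Rightarrow> real" where "\<And>z. exp z - 1 = E z * z" "isCont E 0" "E 0 = 1" "\<And>z. E z > 0"
proof -
  have "DERIV exp (0::real) :> 1" using DERIV_exp[of "0::real"] by simp
  then obtain E where E: "\<And>z. exp z - exp (0::real) = E z * (z - 0)" "isCont E 0" "E 0 = 1"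
    by (auto simp: CARAT_DERIV)
  have "E z > 0" for z
  proof (cases z "0::real" rule: linorder_cases)
    case less
    then have "E z * z < 0" using E(1)[of z] by (metis diff_0_right diff_less_0_iff_less exp_less_cancel_iff)
    then show ?thesis using less by (simp add: mult_less_0_iff)
  next
    case greater
    then have "E z * z > 0" using E(1)[of z] by (metis diff_0_right diff_gt_0_iff_gt exp_less_cancel_iff)
    then show ?thesis using greater by (simp add: zero_less_mult_iff)
  qed (use E(3) in simp)
  then show ?thesis using that[of E] E by simp
qed

text \<open>Up to the factor \<open>1/2\<close>, the objective \<open>J e t\<close> is the divergence from the matrix at
  parameter \<open>e\<close> to the one at parameter \<open>t\<close>: the index \<open>p\<close> runs over pairs of eigenvectors,
  \<open>w p\<close> is their squared inner product, and \<open>k p\<close>, \<open>l p\<close> are the logarithms of the eigenvalues.\<close>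

locale exp_objective =
  fixes w k l :: "'p::finite \<Rightarrow> real"
  assumes w_nonneg: "\<And>p. w p \<ge> 0" and nondegenerate: "\<exists>p. w p \<noteq> 0 \<and> l p \<noteq> 0"
begin

definition J :: "real \<Rightarrow> real \<Rightarrow> real" where
  "J e t = (\<Sum>p\<in>UNIV. w p * (exp (e * k p - t * l p) - 1 - (e * k p - t * l p)))"

text \<open>The negative of the derivative of \<open>J e t\<close> in \<open>t\<close>.\<close>

definition G :: "real \<Rightarrow> real \<Rightarrow> real" where
  "G e t = (\<Sum>p\<in>UNIV. w p * l p * (exp (e * k p - t * l p) - 1))"

definition tmin :: "real \<Rightarrow> real" where
  "tmin e = (SOME t. G e t = 0)"

lemma tmin_exists: "\<exists>t. G e t = 0"
proof -
  \<comment> \<open>Large enough that at \<open>T\<close> and \<open>- T\<close> the term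
    \<open>t * l p\<close> decides the sign of every exponent with \<open>l p \<noteq> 0\<close>, so
    \<open>G e\<close> has opposite weak signs there. Division by zero gives 0, hence indices with
    \<open>l p = 0\<close> add nothing.\<close>
  define T where "T = (\<Sum>p\<in>UNIV. \<bar>e * k p\<bar> / \<bar>l p\<bar>)"
  have T: "\<bar>e * k p\<bar> \<le> T * \<bar>l p\<bar>" if "l p \<noteq> 0" for p
  proof -
    have "\<bar>e * k p\<bar> / \<bar>l p\<bar> \<le> T" unfolding T_def by (rule member_le_sum) auto
    then show ?thesis using that by (simp add: pos_divide_le_eq)
  qed
  have lower: "w p * l p * (exp (e * k p - T * l p) - 1) \<le> 0" for p
  proof (cases "l p" "0::real" rule: linorder_cases)
    case less
    then have "exp (e * k p - T * l p) - 1 \<ge> 0" using T[of p] by auto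
    then show ?thesis using less w_nonneg[of p] by (intro mult_nonpos_nonneg mult_nonneg_nonpos) auto
  next
    case greater
    then have "exp (e * k p - T * l p) - 1 \<le> 0" using T[of p] by auto
    then show ?thesis using greater w_nonneg[of p] by (intro mult_nonneg_nonpos) auto
  qed auto
  have upper: "w p * l p * (exp (e * k p - (- T) * l p) - 1) \<ge> 0" for p
  proof (cases "l p" "0::real" rule: linorder_cases)
    case less
    then have "exp (e * k p - (- T) * l p) - 1 \<le> 0" using T[of p] by auto
    then show ?thesis using less w_nonneg[of p] by (intro mult_nonpos_nonpos mult_nonneg_nonpos) auto
  next
    case greater
    then have "exp (e * k p - (- T) * l p) - 1 \<ge> 0" using T[of p] by auto
    then show ?thesis using greater w_nonneg[of p] by (intro mult_nonneg_nonneg) auto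
  qed auto
  have "G e T \<le> 0" "G e (- T) \<ge> 0"
    unfolding G_def using lower upper by (auto intro!: sum_nonpos sum_nonneg)
  moreover have "T \<ge> 0" unfolding T_def by (intro sum_nonneg) auto
  moreover have "continuous_on {- T..T} (G e)" unfolding G_def by (intro continuous_intros)
  ultimately show ?thesis using IVT2'[of "G e" T 0 "- T"] by auto
qed

lemma G_tmin: "G e (tmin e) = 0"
  unfolding tmin_def using tmin_exists by (rule someI_ex)

text \<open>The tangent inequality of exp, taken at the stationary point and summed with the
  weights. The linear terms add up to a multiple of \<open>G e r\<close>, which is 0, and one index
  with positive weight and \<open>l q \<noteq> 0\<close> makes the inequality strict.\<close>

lemma J_less:
  assumes "G e r = 0" "t \<noteq> r"
  shows "J e r < J e t"
proof -
  define x where "x p = e * k p - t * l p" for p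
  define y where "y p = e * k p - r * l p" for p
  have xy: "x p - y p = (r - t) * l p" for p by (simp add: x_def y_def algebra_simps)
  obtain q where q: "w q > 0" "l q \<noteq> 0" using nondegenerate w_nonneg by (metis less_eq_real_def)
  then have "x q \<noteq> y q" using xy[of q] assms by auto
  have "(\<Sum>p\<in>UNIV. w p * (exp (y p) * (x p - y p))) < (\<Sum>p\<in>UNIV. w p * (exp (x p) - exp (y p)))"
    using q \<open>x q \<noteq> y q\<close>
    by (intro sum_strict_mono_ex1 ballI bexI[of _ q] mult_left_mono exp_tangent_le w_nonneg
        mult_strict_left_mono exp_tangent_less) auto
  moreover have "(\<Sum>p\<in>UNIV. w p * ((exp (y p) - 1) * (x p - y p))) = (r - t) * G e r"
    unfolding xy G_def by (simp add: y_def sum_distrib_left mult_ac)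
  moreover have "J e t - J e r = (\<Sum>p\<in>UNIV. w p * (exp (x p) - exp (y p))) - (\<Sum>p\<in>UNIV. w p * (x p - y p))"
    by (simp add: J_def x_def y_def flip: sum_subtractf) (simp add: algebra_simps)
  moreover have "(\<Sum>p\<in>UNIV. w p * ((exp (y p) - 1) * (x p - y p))) =
      (\<Sum>p\<in>UNIV. w p * (exp (y p) * (x p - y p))) - (\<Sum>p\<in>UNIV. w p * (x p - y p))"
    unfolding sum_subtractf[symmetric] by (intro sum.cong) (auto simp: algebra_simps)
  ultimately show ?thesis using assms(1) by simp
qed

lemma J_tmin_less: "t \<noteq> tmin e \<Longrightarrow> J e (tmin e) < J e t"
  using J_less G_tmin by blast

lemma tmin_unique: "G e r = 0 \<Longrightarrow> tmin e = r"
  using J_less G_tmin by (metis less_asym)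

lemma tmin_0: "tmin 0 = 0"
  by (rule tmin_unique) (simp add: G_def)

text \<open>\<open>N\<close> and \<open>D\<close> are the derivative of \<open>G\<close> in
  \<open>e\<close> and the negative of its derivative in \<open>t\<close>, both at the zero
  \<open>tmin e\<close>; implicit differentiation gives the quotient
  \<open>N e / D e\<close>.\<close>

definition N :: "real \<Rightarrow> real" where
  "N e = (\<Sum>p\<in>UNIV. w p * l p * k p * exp (e * k p - tmin e * l p))"

definition D :: "real \<Rightarrow> real" where
  "D e = (\<Sum>p\<in>UNIV. w p * (l p)\<^sup>2 * exp (e * k p - tmin e * l p))"

lemma weighted_pos:
  assumes "\<And>p. c p > 0"
  shows "(\<Sum>p\<in>UNIV. w p * (l p)\<^sup>2 * c p) > 0"
proof -
  obtain q where q: "w q > 0" "l q \<noteq> 0" using nondegenerate w_nonneg by (metis less_eq_real_def)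
  then show ?thesis using assms w_nonneg
    by (intro sum_pos2[where i=q]) (auto simp: less_imp_le)
qed

lemma D_pos: "D e > 0"
  unfolding D_def by (rule weighted_pos) simp

lemma has_derivative_tmin: "(tmin has_real_derivative N e / D e) (at e)"
proof -
  obtain E :: "real \<Rightarrow> real" where E: "\<And>z. exp z - 1 = E z * z" and E0: "isCont E 0" "E 0 = 1"
    and Epos: "\<And>z. E z > 0" by (rule exp_divided_difference) blast
  define x where "x z p = z * k p - tmin z * l p" for z p
  define c where "c z p = exp (x e p) * E (x z p - x e p)" for z p
  have cpos: "c z p > 0" for z p by (simp add: c_def Epos)
  define n where "n z = (\<Sum>p\<in>UNIV. w p * l p * k p * c z p)" for z
  define d where "d z = (\<Sum>p\<in>UNIV. w p * (l p)\<^sup>2 * c z p)" for z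
  have dpos: "d z > 0" for z unfolding d_def by (rule weighted_pos) (rule cpos)
  \<comment> \<open>Subtracting the stationarity equations at \<open>z\<close> and \<open>e\<close>
    gives an exact identity, valid before \<open>tmin\<close> is known to be continuous.\<close>
  have diff: "(tmin z - tmin e) * d z = (z - e) * n z" for z
  proof -
    have "exp (x z p) - exp (x e p) = c z p * ((z - e) * k p - (tmin z - tmin e) * l p)" for p
    proof -
      have "exp (x z p) - exp (x e p) = exp (x e p) * (exp (x z p - x e p) - 1)"
        by (simp add: exp_diff algebra_simps)
      also have "\<dots> = c z p * (x z p - x e p)" unfolding E c_def by simp
      finally show ?thesis by (simp add: x_def algebra_simps)
    qed
    moreover have "(\<Sum>p\<in>UNIV. w p * l p * (exp (x z p) - exp (x e p))) = G z (tmin z) - G e (tmin e)"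
      by (simp add: G_def x_def algebra_simps sum_subtractf)
    ultimately have "(\<Sum>p\<in>UNIV. w p * l p * (c z p * ((z - e) * k p - (tmin z - tmin e) * l p))) = 0"
      by (simp add: G_tmin)
    moreover have "(\<Sum>p\<in>UNIV. w p * l p * (c z p * ((z - e) * k p - (tmin z - tmin e) * l p)))
        = (z - e) * n z - (tmin z - tmin e) * d z"
      unfolding n_def d_def sum_distrib_left sum_subtractf[symmetric]
      by (intro sum.cong) (auto simp: algebra_simps power2_eq_square)
    ultimately show ?thesis by simp
  qed
  \<comment> \<open>Both sums carry the same positive factors \<open>c z p\<close>, so comparing
    them term by term bounds \<open>n z / d z\<close> uniformly in \<open>z\<close>. This yields the
    Lipschitz bound, then continuity of \<open>tmin\<close>, and with it continuity of the quotient
    at \<open>e\<close>.\<close>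
  define M where "M = (\<Sum>p\<in>UNIV. \<bar>k p\<bar> / \<bar>l p\<bar>)"
  have "\<bar>n z\<bar> \<le> M * d z" for z
  proof -
    have "\<bar>w p * l p * k p * c z p\<bar> \<le> M * (w p * (l p)\<^sup>2 * c z p)" for p
    proof (cases "l p = 0")
      case False
      have "\<bar>k p\<bar> / \<bar>l p\<bar> \<le> M" unfolding M_def by (rule member_le_sum) auto
      then have "\<bar>k p\<bar> \<le> M * \<bar>l p\<bar>" using False by (simp add: pos_divide_le_eq)
      then have "w p * \<bar>l p\<bar> * c z p * \<bar>k p\<bar> \<le> w p * \<bar>l p\<bar> * c z p * (M * \<bar>l p\<bar>)"
        using w_nonneg[of p] cpos[of z p] by (intro mult_left_mono) auto
      moreover have "\<bar>w p * l p * k p * c z p\<bar> = w p * \<bar>l p\<bar> * c z p * \<bar>k p\<bar>"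
        using w_nonneg[of p] cpos[of z p] by (simp add: abs_mult mult_ac)
      moreover have "M * (w p * \<bar>l p\<bar>\<^sup>2 * c z p) = w p * \<bar>l p\<bar> * c z p * (M * \<bar>l p\<bar>)"
        by (simp only: power2_eq_square mult_ac)
      ultimately show ?thesis unfolding power2_abs by linarith
    qed simp
    then show ?thesis unfolding n_def d_def sum_distrib_left
      by (intro order_trans[OF sum_abs] sum_mono)
  qed
  then have lip: "\<bar>tmin z - tmin e\<bar> \<le> M * \<bar>z - e\<bar>" for z
  proof -
    have "\<bar>tmin z - tmin e\<bar> * d z = \<bar>z - e\<bar> * \<bar>n z\<bar>"
      using arg_cong[OF diff[of z], of abs] dpos[of z] by (simp add: abs_mult)
    also have "\<dots> \<le> \<bar>z - e\<bar> * (M * d z)" using \<open>\<bar>n z\<bar> \<le> M * d z\<close> by (intro mult_left_mono) auto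
    finally have "\<bar>tmin z - tmin e\<bar> * d z \<le> (M * \<bar>z - e\<bar>) * d z" by (simp add: mult_ac)
    then show ?thesis using dpos[of z] by simp
  qed
  have "((\<lambda>z. tmin z - tmin e) \<longlongrightarrow> 0) (at e)"
  proof (rule Lim_null_comparison)
    show "\<forall>\<^sub>F z in at e. norm (tmin z - tmin e) \<le> M * \<bar>z - e\<bar>" using lip by simp
    show "((\<lambda>z. M * \<bar>z - e\<bar>) \<longlongrightarrow> 0) (at e)" by (auto intro!: tendsto_eq_intros)
  qed
  then have cont: "isCont tmin e" by (simp add: isCont_def LIM_zero_iff)
  have contc: "isCont (\<lambda>z. c z p) e" for p
  proof -
    have "isCont (\<lambda>z. x z p - x e p) e" unfolding x_def using cont by (intro continuous_intros)
    moreover have "isCont E (x e p - x e p)" using E0 by simp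
    ultimately have "isCont (\<lambda>z. E (x z p - x e p)) e"
      by (rule isCont_o2[of e "\<lambda>z. x z p - x e p" E])
    then show ?thesis unfolding c_def by (intro continuous_intros)
  qed
  have "isCont (\<lambda>z. n z / d z) e"
    unfolding n_def d_def using contc dpos[of e] by (intro continuous_intros) (auto simp: d_def)
  moreover have "tmin z - tmin e = n z / d z * (z - e)" for z
    using diff[of z] dpos[of z] by (simp add: field_simps)
  moreover have "n e / d e = N e / D e"
    by (simp add: n_def d_def N_def D_def c_def x_def E0)
  ultimately show ?thesis unfolding CARAT_DERIV
    by (intro exI[of _ "\<lambda>z. n z / d z"] conjI allI)
qed

text \<open>An algebra of functions that contains the derivative of \<open>tmin\<close> and is closed under
  differentiation, whence \<open>tmin\<close> is smooth.\<close>

inductive_set expalg :: "(real \<Rightarrow> real) set" where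
  const: "(\<lambda>_. c) \<in> expalg"
| exp: "(\<lambda>e. exp (e * a - tmin e * b)) \<in> expalg"
| inv: "(\<lambda>e. inverse (D e)) \<in> expalg"
| add: "f \<in> expalg \<Longrightarrow> g \<in> expalg \<Longrightarrow> (\<lambda>e. f e + g e) \<in> expalg"
| mult: "f \<in> expalg \<Longrightarrow> g \<in> expalg \<Longrightarrow> (\<lambda>e. f e * g e) \<in> expalg"

lemma expalg_sum: "finite S \<Longrightarrow> (\<And>p. p \<in> S \<Longrightarrow> f p \<in> expalg) \<Longrightarrow> (\<lambda>e. \<Sum>p\<in>S. f p e) \<in> expalg"
  by (induction S rule: finite_induct) (auto intro: expalg.intros)

text \<open>Written with \<open>inverse\<close> so that membership in \<open>expalg\<close> follows
  directly from its introduction rules.\<close>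

definition tmin' :: "real \<Rightarrow> real" where
  "tmin' e = N e * inverse (D e)"

lemma tmin'_expalg: "tmin' \<in> expalg"
  unfolding tmin'_def N_def by (intro expalg.intros expalg_sum) auto

lemma tmin_deriv: "(tmin has_real_derivative tmin' e) (at e)"
  using has_derivative_tmin[of e] by (simp add: tmin'_def divide_inverse)

definition D' :: "real \<Rightarrow> real" where
  "D' e = (\<Sum>p\<in>UNIV. w p * (l p)\<^sup>2 * (exp (e * k p - tmin e * l p) * (k p + tmin' e * - l p)))"

lemma D_deriv: "(D has_real_derivative D' e) (at e)"
proof -
  have "((\<lambda>e. D e) has_real_derivative D' e) (at e)"
    unfolding D_def D'_def by (auto intro!: derivative_eq_intros tmin_deriv sum.cong)
  then show ?thesis by simp
qed

lemma expalg_deriv: "f \<in> expalg \<Longrightarrow> \<exists>g\<in>expalg. \<forall>e. (f has_real_derivative g e) (at e)"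
proof (induction rule: expalg.induct)
  case (const c)
  then show ?case by (intro bexI[of _ "\<lambda>_. 0"] expalg.const) auto
next
  case (exp a b)
  have "(\<lambda>e. exp (e * a - tmin e * b) * (a + tmin' e * - b)) \<in> expalg"
    by (intro expalg.intros tmin'_expalg)
  moreover have "((\<lambda>e. exp (e * a - tmin e * b)) has_real_derivative
      exp (e * a - tmin e * b) * (a + tmin' e * - b)) (at e)" for e
    by (auto intro!: derivative_eq_intros tmin_deriv)
  ultimately show ?case by (intro bexI[rotated] allI)
next
  case inv
  have "D' \<in> expalg" unfolding D'_def
    by (intro expalg.intros expalg_sum tmin'_expalg) auto
  then have "(\<lambda>e. - 1 * (inverse (D e) * (D' e * inverse (D e)))) \<in> expalg"
    by (intro expalg.intros)
  moreover have "((\<lambda>e. inverse (D e)) has_real_derivative - 1 * (inverse (D e) * (D' e * inverse (D e)))) (at e)" for e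
    using D_pos[of e] by (auto intro!: derivative_eq_intros D_deriv)
  ultimately show ?case by (intro bexI[rotated] allI)
next
  case (add f g)
  then obtain f' g' where "f' \<in> expalg" "g' \<in> expalg" and
    d: "\<And>e. (f has_real_derivative f' e) (at e)" "\<And>e. (g has_real_derivative g' e) (at e)" by blast
  then have "(\<lambda>e. f' e + g' e) \<in> expalg" by (intro expalg.intros)
  then show ?case by (rule rev_bexI) (intro allI DERIV_add d)
next
  case (mult f g)
  then obtain f' g' where "f' \<in> expalg" "g' \<in> expalg" and
    d: "\<And>e. (f has_real_derivative f' e) (at e)" "\<And>e. (g has_real_derivative g' e) (at e)" by blast
  then have "(\<lambda>e. f' e * g e + g' e * f e) \<in> expalg" using mult by (intro expalg.intros)
  then show ?case by (rule rev_bexI) (intro allI DERIV_mult d)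
qed

lemma expalg_iterated_deriv: "f \<in> expalg \<Longrightarrow> (deriv ^^ i) f \<in> expalg"
proof (induction i)
  case (Suc i)
  then obtain g where g: "g \<in> expalg" "\<And>e. ((deriv ^^ i) f has_real_derivative g e) (at e)"
    using expalg_deriv by blast
  then have "deriv ((deriv ^^ i) f) = g" by (auto intro: DERIV_imp_deriv)
  then show ?case using g by simp
qed simp

lemma deriv_tmin: "deriv tmin = tmin'"
  by (rule ext) (rule DERIV_imp_deriv[OF tmin_deriv])

lemma smooth_tmin: "(deriv ^^ i) tmin field_differentiable at x"
proof (cases i)
  case 0
  then show ?thesis using tmin_deriv by (auto simp: field_differentiable_def)
next
  case (Suc j)
  have "(deriv ^^ i) tmin = (deriv ^^ j) tmin'"
    by (simp only: Suc funpow_Suc_right comp_apply deriv_tmin)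
  then show ?thesis
    using expalg_deriv[OF expalg_iterated_deriv[OF tmin'_expalg, of j]] by (auto simp: field_differentiable_def)
qed

text \<open>Orthogonality gives \<open>N 0 = 0\<close>, so \<open>tmin' 0 = 0\<close>. Both the
  contribution of \<open>D'\<close> and the part of the derivative of \<open>N\<close> that passes
  through \<open>tmin\<close> then vanish at 0.\<close>

lemma deriv2_tmin:
  assumes orth: "(\<Sum>p\<in>UNIV. w p * k p * l p) = 0"
  shows "(deriv ^^ 2) tmin 0 = (\<Sum>p\<in>UNIV. w p * (k p)\<^sup>2 * l p) / (\<Sum>p\<in>UNIV. w p * (l p)\<^sup>2)"
proof -
  have N0: "N 0 = 0" using orth by (simp add: N_def tmin_0 mult_ac)
  then have r0: "tmin' 0 = 0" by (simp add: tmin'_def)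
  have "((\<lambda>e. N e) has_real_derivative (\<Sum>p\<in>UNIV. w p * (k p)\<^sup>2 * l p)) (at 0)"
    unfolding N_def
    by (auto intro!: derivative_eq_intros tmin_deriv sum.cong simp: r0 tmin_0 power2_eq_square)
  then have "(tmin' has_real_derivative (\<Sum>p\<in>UNIV. w p * (k p)\<^sup>2 * l p) / D 0) (at 0)"
    unfolding tmin'_def using D_pos[of 0]
    by (auto intro!: derivative_eq_intros D_deriv simp: N0 divide_inverse)
  moreover have "D 0 = (\<Sum>p\<in>UNIV. w p * (l p)\<^sup>2)" by (simp add: D_def tmin_0)
  ultimately show ?thesis by (simp add: numeral_2_eq_2 deriv_tmin DERIV_imp_deriv)
qed

end

text \<open>The coefficients cover both uses: (0, -1) for the I-projection and (1, 1) for the even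
  difference of the two projections.\<close>

lemma iterated_deriv_reflect:
  fixes f :: "real \<Rightarrow> real"
  assumes f: "\<And>i x. (deriv ^^ i) f field_differentiable at x"
  shows "(deriv ^^ i) (\<lambda>x. a * f x + b * f (- x)) =
    (\<lambda>x. a * (deriv ^^ i) f x + b * (- 1) ^ i * (deriv ^^ i) f (- x))"
proof (induction i)
  case (Suc i)
  have d: "((deriv ^^ i) f has_real_derivative (deriv ^^ Suc i) f x) (at x)" for x
    using f[of i x] by (simp add: DERIV_deriv_iff_field_differentiable)
  have d': "((\<lambda>x. (deriv ^^ i) f (- x)) has_real_derivative - (deriv ^^ Suc i) f (- x)) (at x)" for x
    using DERIV_mirror[THEN iffD1, OF d[of "- x"]] .
  have "((\<lambda>x. a * (deriv ^^ i) f x + b * (- 1) ^ i * (deriv ^^ i) f (- x)) has_real_derivative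
      a * (deriv ^^ Suc i) f x + b * (- 1) ^ Suc i * (deriv ^^ Suc i) f (- x)) (at x)" for x
    by (rule derivative_eq_intros d d' refl)+ simp
  from DERIV_imp_deriv[OF this] show ?case by (simp add: Suc fun_eq_iff)
qed simp

lemma smooth_reflect:
  fixes f :: "real \<Rightarrow> real"
  assumes f: "\<And>i x. (deriv ^^ i) f field_differentiable at x"
  shows "(deriv ^^ i) (\<lambda>x. a * f x + b * f (- x)) field_differentiable at x"
proof -
  have d: "((deriv ^^ i) f has_real_derivative deriv ((deriv ^^ i) f) y) (at y)" for y
    using f[of i y] by (simp add: DERIV_deriv_iff_field_differentiable)
  from DERIV_add[OF DERIV_cmult[OF d] DERIV_cmult[OF DERIV_mirror[THEN iffD1, OF d]]]
  show ?thesis unfolding iterated_deriv_reflect[OF f] field_differentiable_def by blast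
qed

text \<open>The Lagrange remainder, with the \<open>n\<close>-th derivative bounded by compactness
  on [-1, 1].\<close>

lemma taylor_bigo:
  fixes f :: "real \<Rightarrow> real"
  assumes f: "\<And>i x. (deriv ^^ i) f field_differentiable at x"
  shows "(\<lambda>x. f x - (\<Sum>j<n. (deriv ^^ j) f 0 / fact j * x ^ j)) \<in> O[at 0](\<lambda>x. x ^ n)"
proof -
  have d: "((deriv ^^ i) f has_real_derivative (deriv ^^ Suc i) f x) (at x)" for x i
    using f[of i x] by (simp add: DERIV_deriv_iff_field_differentiable)
  have "continuous_on {-1..1} ((deriv ^^ n) f)"
    using d[of n] by (intro continuous_at_imp_continuous_on) (auto intro: DERIV_isCont)
  then have "bounded ((deriv ^^ n) f ` {-1..1})"
    by (intro compact_imp_bounded compact_continuous_image) auto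
  then obtain B where B: "\<And>t. t \<in> {-1..1} \<Longrightarrow> \<bar>(deriv ^^ n) f t\<bar> \<le> B"
    unfolding bounded_iff real_norm_def by blast
  have "\<bar>f x - (\<Sum>j<n. (deriv ^^ j) f 0 / fact j * x ^ j)\<bar> \<le> B / fact n * \<bar>x ^ n\<bar>" if "\<bar>x\<bar> < 1" for x
  proof -
    obtain t where t: "\<bar>t\<bar> \<le> \<bar>x\<bar>"
      "f x = (\<Sum>j<n. (deriv ^^ j) f 0 / fact j * x ^ j) + (deriv ^^ n) f t / fact n * x ^ n"
      using Maclaurin_all_le[of "\<lambda>i. (deriv ^^ i) f" f x n] d by auto
    have "\<bar>f x - (\<Sum>j<n. (deriv ^^ j) f 0 / fact j * x ^ j)\<bar> = \<bar>(deriv ^^ n) f t\<bar> / fact n * \<bar>x ^ n\<bar>"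
      by (simp add: t(2) abs_mult)
    also have "\<dots> \<le> B / fact n * \<bar>x ^ n\<bar>"
      using t(1) that by (intro mult_right_mono divide_right_mono B) auto
    finally show ?thesis .
  qed
  then show ?thesis
    by (intro bigoI[where c = "B / fact n"]) (auto simp: eventually_at dist_real_def intro!: exI[of _ 1])
qed

section \<open>Projections onto the geodesic\<close>

text \<open>A congruence of both arguments replaces \<open>matrix_inv B ** A\<close> by a similar
  matrix, and the divergence sees only its trace and determinant.\<close>

lemma KL_normal_congruence:
  fixes A B F :: "real^'n^'n"
  assumes B: "B \<in> SPD" and F: "invertible F"
  shows "KL_normal (F ** A ** transpose F) (F ** B ** transpose F) = KL_normal A B"
proof -
  obtain E where FE: "F ** E = mat 1" and EF: "E ** F = mat 1" using F by (auto simp: invertible_def)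
  have tEF: "transpose E ** transpose F = mat 1" "transpose F ** transpose E = mat 1"
    using FE EF by (metis matrix_transpose_mul transpose_mat)+
  define B' where "B' = matrix_inv B"
  have BB: "B ** B' = mat 1"
    unfolding B'_def using B mpow_inverse[OF B, of 1] by (simp add: mpow_1) (metis matrix_inv_eq)
  have "(F ** B ** transpose F) ** (transpose E ** B' ** E) = mat 1"
    by (simp add: matrix_mul_assoc matrix_mul_cancel tEF BB FE)
  then have "matrix_inv (F ** B ** transpose F) = transpose E ** B' ** E" by (rule matrix_inv_eq)
  then have eq: "matrix_inv (F ** B ** transpose F) ** (F ** A ** transpose F) = transpose E ** (B' ** A) ** transpose F"
    by (simp add: matrix_mul_assoc matrix_mul_cancel EF)
  have "trace (transpose E ** (B' ** A) ** transpose F) = trace (B' ** A)"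
    by (subst trace_mul_sym) (simp add: matrix_mul_assoc tEF)
  moreover have "det (transpose E ** (B' ** A) ** transpose F) = det (B' ** A)"
    using arg_cong[OF tEF(1), of det] by (simp add: det_mul)
  ultimately show ?thesis by (simp add: KL_normal_def eq B'_def)
qed

lemma KL_normal_spec:
  fixes P Q :: "real^'n^'n"
  assumes P: "orthogonal_matrix P" and Q: "orthogonal_matrix Q"
  shows "KL_normal (spec P (vexp a)) (spec Q (vexp b)) =
    (\<Sum>i\<in>UNIV. \<Sum>j\<in>UNIV. overlap P Q i j * (exp (a $ i - b $ j) - 1 - (a $ i - b $ j))) / 2"
proof -
  have "trace (matrix_inv (spec Q (vexp b)) ** spec P (vexp a)) =
      (\<Sum>i\<in>UNIV. \<Sum>j\<in>UNIV. overlap P Q i j * exp (a $ i - b $ j))"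
    unfolding matrix_inv_spec[OF Q]
    by (subst trace_mul_sym) (simp add: trace_spec_mult flip: exp_add)
  moreover have "det (matrix_inv (spec Q (vexp b)) ** spec P (vexp a)) = exp ((\<Sum>i\<in>UNIV. a $ i) - (\<Sum>i\<in>UNIV. b $ i))"
    by (simp add: matrix_inv_spec det_mul det_spec P Q sum_negf flip: exp_add)
  moreover have "real CARD('n) = (\<Sum>i\<in>UNIV. \<Sum>j\<in>UNIV. overlap P Q i j)"
    using sum_overlap_left[OF P Q, of "\<lambda>_. 1"] by simp
  moreover have "(\<Sum>i\<in>UNIV. a $ i) = (\<Sum>i\<in>UNIV. \<Sum>j\<in>UNIV. overlap P Q i j * a $ i)"
      "(\<Sum>i\<in>UNIV. b $ i) = (\<Sum>i\<in>UNIV. \<Sum>j\<in>UNIV. overlap P Q i j * b $ j)"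
    by (simp_all add: sum_overlap_left[OF P Q] sum_overlap_right[OF P Q])
  ultimately show ?thesis
    by (simp add: KL_normal_def right_diff_distrib sum.distrib sum_subtractf)
qed

text \<open>Geodesics from the same point share the outer congruence factor, which the invariance of
  the distance and of the divergence removes.\<close>

lemma geodesic_spec:
  assumes "orthogonal_matrix Q" "whiten A B = spec Q (vexp l)" "A \<in> SPD"
  shows "geodesic A B t = mpow A (1/2) ** spec Q (vexp (t *\<^sub>R l)) ** transpose (mpow A (1/2))"
  using assms by (simp add: geodesic_def mpow_spec transpose_SPD mpow_in_SPD)

lemma nat_dist_spec_spec_ge:
  assumes "orthogonal_matrix P" "orthogonal_matrix Q"
  shows "norm (spec P a - spec Q b) \<le> nat_dist (spec P (vexp a)) (spec Q (vexp b))"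
  using log_m_diff_le_nat_dist[OF spec_in_SPD spec_in_SPD] assms by (metis log_m_spec)

lemma spec_scaleR: "spec Q (c *\<^sub>R d) = c *\<^sub>R spec Q d"
proof -
  have "diag (c *\<^sub>R d) = c *\<^sub>R diag d" by (simp add: diag_def vec_eq_iff)
  then show ?thesis
    by (simp add: spec_def matrix_scalar_ac scalar_matrix_assoc)
qed

text \<open>First-order condition for a nearest point. The distance is only controlled to second order near
  the base point, so the competitor at parameter \<open>a s\<close> is compared with the point at parameter \<open>s\<close>
  of the geodesic to the target, which is then joined to the target by the triangle inequality.\<close>

lemma nearest_point_orthogonal:
  fixes U V :: "real^'n^'n"
  assumes U: "orthogonal_matrix U" and V: "orthogonal_matrix V"
    and min: "\<And>t. norm k \<le> nat_dist (spec U (vexp (t *\<^sub>R l))) (spec V (vexp k))"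
  shows "spec U l \<bullet> spec V k = 0"
proof (rule ccontr)
  define L where "L = spec U l"
  define K where "K = spec V k"
  assume "spec U l \<bullet> spec V k \<noteq> 0"
  then have LK: "L \<bullet> K \<noteq> 0" and L: "L \<noteq> 0" by (auto simp: L_def K_def)
  \<comment> \<open>The coefficient of the orthogonal projection of \<open>K\<close> onto the line
    through \<open>L\<close>. If it is nonzero, that multiple of \<open>L\<close> is strictly closer
    to \<open>K\<close> than 0 is, against the limit inequality below.\<close>
  define a where "a = (L \<bullet> K) / (L \<bullet> L)"
  have invV: "invertible V" using V by (metis orthogonal_matrix_def invertible_def)
  \<comment> \<open>The \<open>sym_KL\<close> of the points at parameters \<open>a * s\<close> and
    \<open>s\<close>, divided by the square of \<open>s\<close>; its limit at 0 is the squared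
    Euclidean distance from \<open>a *\<^sub>R L\<close> to \<open>K\<close>.\<close>
  define f where "f s = (\<Sum>i\<in>UNIV. \<Sum>j\<in>UNIV. overlap U V i j * ((2 * cosh ((a * l $ i - k $ j) * s) - 2) / s\<^sup>2))" for s
  have "(norm K)\<^sup>2 \<le> f s" if "0 < s" "s < 1" for s
  proof -
    let ?X = "spec U (vexp ((a * s) *\<^sub>R l))" and ?Y = "spec V (vexp (s *\<^sub>R k))"
    have "norm k \<le> nat_dist ?X (spec V (vexp k))" by (rule min)
    also have "\<dots> \<le> nat_dist ?X ?Y + nat_dist ?Y (spec V (vexp k))"
      by (intro nat_dist_triangle spec_in_SPD U V)
    also have "nat_dist ?Y (spec V (vexp k)) = norm ((s - 1) *\<^sub>R k)"
      by (simp add: nat_dist_spec invV scaleR_diff_left)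
    also have "\<dots> = (1 - s) * norm k" using that by simp
    finally have "s * norm k \<le> nat_dist ?X ?Y" by (simp add: algebra_simps)
    then have "(s * norm k)\<^sup>2 \<le> (nat_dist ?X ?Y)\<^sup>2" using that by (intro power_mono) auto
    also have "\<dots> \<le> sym_KL ?X ?Y" by (intro nat_dist_le_sym_KL spec_in_SPD U V)
    also have "\<dots> = s\<^sup>2 * f s"
    proof -
      have "((a * s) *\<^sub>R l) $ i - (s *\<^sub>R k) $ j = (a * l $ i - k $ j) * s" for i j
        by (simp add: algebra_simps)
      then show ?thesis
        unfolding sym_KL_orthogonal[OF U V] f_def sum_distrib_left using that
        by (intro sum.cong refl) simp
    qed
    finally have "s\<^sup>2 * (norm k)\<^sup>2 \<le> s\<^sup>2 * f s" by (simp add: power_mult_distrib)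
    then show ?thesis using that by (simp add: K_def norm_spec V)
  qed
  then have "\<forall>\<^sub>F s in at_right 0. (norm K)\<^sup>2 \<le> f s"
    by (auto simp: eventually_at_right_field intro!: exI[of _ 1])
  moreover have lim: "((\<lambda>s. (2 * cosh (x * s) - 2) / s\<^sup>2) \<longlongrightarrow> x\<^sup>2) (at_right 0)" for x :: real
    unfolding power2_eq_square[of x] by real_asymp
  have "(f \<longlongrightarrow> (\<Sum>i\<in>UNIV. \<Sum>j\<in>UNIV. overlap U V i j * (a * l $ i - k $ j)\<^sup>2)) (at_right 0)"
    unfolding f_def by (intro tendsto_sum tendsto_mult tendsto_const lim)
  ultimately have "(norm K)\<^sup>2 \<le> (\<Sum>i\<in>UNIV. \<Sum>j\<in>UNIV. overlap U V i j * (a * l $ i - k $ j)\<^sup>2)"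
    by (intro tendsto_lowerbound) auto
  also have "\<dots> = (norm (a *\<^sub>R L - K))\<^sup>2"
    using norm_spec_diff[OF U V, of "a *\<^sub>R l" k] by (simp add: L_def K_def spec_scaleR)
  also have "\<dots> = (norm K)\<^sup>2 - (L \<bullet> K)\<^sup>2 / (L \<bullet> L)"
    unfolding power2_norm_eq_inner using L
    by (simp add: algebra_simps inner_commute a_def power2_eq_square)
  finally have "(L \<bullet> K)\<^sup>2 / (L \<bullet> L) \<le> 0" by simp
  moreover have "(L \<bullet> K)\<^sup>2 / (L \<bullet> L) > 0" using LK L by simp
  ultimately show False by simp
qed

text \<open>\<open>arg_min\<close> is a choice operator, so its value is determined only through
  strict minimality.\<close>

lemma arg_min_unique:
  fixes f :: "'a \<Rightarrow> real"
  assumes "\<And>t. t \<noteq> r \<Longrightarrow> f r < f t"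
  shows "arg_min f (\<lambda>_. True) = r"
proof -
  have "is_arg_min f (\<lambda>_. True) t \<longleftrightarrow> t = r" for t
    using assms by (auto simp: is_arg_min_def) (metis less_asym)+
  then show ?thesis unfolding arg_min_def by auto
qed

theorem theorem4p3:
  fixes A1 A2 C :: "real^'n^'n"
  assumes "A1 \<in> SPD" and "A2 \<in> SPD" and "C \<in> SPD" and "A1 \<noteq> A2"
    and "is_arg_min (\<lambda>t::real. nat_dist (geodesic A1 A2 t) C) (\<lambda>_. True) 0"
  shows
    "(\<forall>\<epsilon>. nat_dist (geodesic A1 A2 (t_star A1 A2 C \<epsilon>)) (geodesic A1 C \<epsilon>)
            = \<bar>\<epsilon>\<bar> * nat_dist A1 C) \<and>
     smooth_near_0 (Dt_hat A1 A2 C) \<and> smooth_near_0 (Dt_check A1 A2 C) \<and>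
     (\<forall>i. odd i \<longrightarrow> (deriv ^^ i) (Dt_hat A1 A2 C) 0 = (deriv ^^ i) (Dt_check A1 A2 C) 0) \<and>
     (\<forall>i. even i \<longrightarrow> (deriv ^^ i) (Dt_hat A1 A2 C) 0 = - (deriv ^^ i) (Dt_check A1 A2 C) 0) \<and>
     (\<forall>k. (\<lambda>\<epsilon>. (t_hat A1 A2 C \<epsilon> - t_check A1 A2 C \<epsilon>)
               - (\<Sum>j\<le>2*k. (deriv ^^ j) (\<lambda>e. t_hat A1 A2 C e - t_check A1 A2 C e) 0
                           / fact j * \<epsilon> ^ j))
           \<in> O[at 0](\<lambda>\<epsilon>. \<epsilon> ^ (2*k + 2))) \<and>
     (\<lambda>\<epsilon>. (t_hat A1 A2 C \<epsilon> - t_check A1 A2 C \<epsilon>)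
           - (deriv ^^ 2) (Dt_hat A1 A2 C) 0 * \<epsilon> ^ 2)
       \<in> O[at 0](\<lambda>\<epsilon>. \<epsilon> ^ 4) \<and>
     (deriv ^^ 2) (Dt_hat A1 A2 C) 0 =
       trace (log_m (whiten A1 C) ** log_m (whiten A1 C) ** log_m (whiten A1 A2))
         / (nat_dist A1 A2)\<^sup>2"
proof -
  obtain U l where U: "orthogonal_matrix U" and l: "whiten A1 A2 = spec U (vexp l)"
    using SPD_spec_cases whiten_in_SPD[OF assms(1,2)] by metis
  obtain V k where V: "orthogonal_matrix V" and k: "whiten A1 C = spec V (vexp k)"
    using SPD_spec_cases whiten_in_SPD[OF assms(1,3)] by metis
  define F where "F = mpow A1 (1/2)"
  have F: "invertible F" unfolding F_def by (rule invertible_mpow[OF assms(1)])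
  have geoA: "geodesic A1 A2 t = F ** spec U (vexp (t *\<^sub>R l)) ** transpose F" for t
    unfolding F_def by (rule geodesic_spec[OF U l assms(1)])
  have geoC: "geodesic A1 C e = F ** spec V (vexp (e *\<^sub>R k)) ** transpose F" for e
    unfolding F_def by (rule geodesic_spec[OF V k assms(1)])
  have "F ** transpose F = A1"
    using assms(1) by (simp add: F_def transpose_SPD mpow_in_SPD mpow_add mpow_1)
  have C: "geodesic A1 C 1 = C" and A2: "geodesic A1 A2 1 = A2"
    using unwhiten[OF assms(1)] assms by (simp_all add: geodesic_def mpow_1 whiten_in_SPD)
  have dist: "nat_dist (geodesic A1 A2 t) (geodesic A1 C e) =
      nat_dist (spec U (vexp (t *\<^sub>R l))) (spec V (vexp (e *\<^sub>R k)))" for t e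
    unfolding geoA geoC by (intro nat_dist_congruence spec_in_SPD U V F)
  have invV: "invertible V" using V by (metis orthogonal_matrix_def invertible_def)
  have dist0: "nat_dist (geodesic A1 A2 0) (geodesic A1 C e) = \<bar>e\<bar> * norm k" for e
  proof -
    have "spec U (vexp (0 *\<^sub>R l)) = spec V (vexp 0)" using U V by (simp add: spec_vexp_0)
    then show ?thesis by (simp add: dist nat_dist_spec[OF invV])
  qed
  have normk: "nat_dist A1 C = norm k" and norml: "nat_dist A1 A2 = norm l"
    using U V by (simp_all add: nat_dist_def l k log_m_spec norm_spec)

  \<comment> \<open>The minimality hypothesis concerns only \<open>C\<close>, that is parameter 1;
    orthogonality carries it over to every parameter.\<close>
  have "norm k \<le> nat_dist (spec U (vexp (t *\<^sub>R l))) (spec V (vexp k))" for t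
    using assms(5) dist0[of 1] dist[of t 1] by (auto simp: is_arg_min_linorder C dest: spec[of _ t])
  then have orth: "spec U l \<bullet> spec V k = 0" by (rule nearest_point_orthogonal[OF U V])

  have "l \<noteq> 0"
  proof
    assume "l = 0"
    then have "A2 = F ** transpose F" using geoA[of 1] A2 U by (simp add: spec_vexp_0)
    then show False using assms(4) \<open>F ** transpose F = A1\<close> by simp
  qed

  have t_star: "t_star A1 A2 C e = 0" for e
    unfolding t_star_def natural_proj_def
  proof (rule arg_min_unique)
    fix t :: real assume "t \<noteq> 0"
    have "(\<bar>e\<bar> * norm k)\<^sup>2 < (norm (t *\<^sub>R spec U l - e *\<^sub>R spec V k))\<^sup>2"
    proof -
      have "(norm (t *\<^sub>R spec U l - e *\<^sub>R spec V k))\<^sup>2 = t\<^sup>2 * (norm l)\<^sup>2 + e\<^sup>2 * (norm k)\<^sup>2"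
        using orth norm_spec[OF U, of l] norm_spec[OF V, of k] unfolding power2_norm_eq_inner
        by (simp add: algebra_simps inner_commute power2_eq_square norm_eq_sqrt_inner)
      then show ?thesis using \<open>t \<noteq> 0\<close> \<open>l \<noteq> 0\<close> by (simp add: power_mult_distrib)
    qed
    then have "\<bar>e\<bar> * norm k < norm (t *\<^sub>R spec U l - e *\<^sub>R spec V k)"
      by (rule power_less_imp_less_base) simp
    also have "\<dots> \<le> nat_dist (geodesic A1 A2 t) (geodesic A1 C e)"
      unfolding dist using nat_dist_spec_spec_ge[OF U V] by (simp flip: spec_scaleR)
    finally show "nat_dist (geodesic A1 A2 0) (geodesic A1 C e) < nat_dist (geodesic A1 A2 t) (geodesic A1 C e)"
      by (simp add: dist0)
  qed

  define w where "w p = overlap V U (fst p) (snd p)" for p :: "'n \<times> 'n"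
  define kk where "kk p = k $ fst p" for p :: "'n \<times> 'n"
  define ll where "ll p = l $ snd p" for p :: "'n \<times> 'n"
  have pairs: "(\<Sum>p\<in>UNIV. w p * f (kk p) (ll p)) = (\<Sum>i\<in>UNIV. \<Sum>j\<in>UNIV. overlap V U i j * f (k $ i) (l $ j))"
    for f :: "real \<Rightarrow> real \<Rightarrow> real"
    by (simp add: w_def kk_def ll_def sum.cartesian_product case_prod_unfold)
  interpret exp_objective w kk ll
  proof
    show "w p \<ge> 0" for p by (simp add: w_def overlap_nonneg)
    obtain j where j: "l $ j \<noteq> 0" using \<open>l \<noteq> 0\<close> by (auto simp: vec_eq_iff)
    \<comment> \<open>The weights belonging to \<open>j\<close> sum to 1, so they cannot all
      vanish.\<close>
    have "\<exists>i. overlap V U i j \<noteq> 0"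
      using overlap_sums(2)[OF V U, of j] by (metis sum.neutral zero_neq_one)
    then show "\<exists>p. w p \<noteq> 0 \<and> ll p \<noteq> 0" using j by (auto simp: w_def ll_def)
  qed
  have KL: "KL_normal (geodesic A1 C e) (geodesic A1 A2 t) = J e t / 2" for e t
    unfolding geoA geoC KL_normal_congruence[OF spec_in_SPD[OF U] F] KL_normal_spec[OF V U] J_def
    using pairs[of "\<lambda>x y. exp (e * x - t * y) - 1 - (e * x - t * y)"] by simp
  have KL': "KL_normal (geodesic A1 A2 t) (geodesic A1 C e) = J (- e) (- t) / 2" for e t
  proof -
    have "KL_normal (geodesic A1 A2 t) (geodesic A1 C e) =
      (\<Sum>j\<in>UNIV. \<Sum>i\<in>UNIV. overlap V U i j * (exp (t * l $ j - e * k $ i) - 1 - (t * l $ j - e * k $ i))) / 2"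
      unfolding geoA geoC KL_normal_congruence[OF spec_in_SPD[OF V] F] KL_normal_spec[OF U V] overlap_commute[of U V] by simp
    also have "\<dots> = J (- e) (- t) / 2"
      unfolding J_def pairs[of "\<lambda>x y. exp ((- e) * x - (- t) * y) - 1 - ((- e) * x - (- t) * y)"]
      by (subst sum.swap) (simp add: algebra_simps)
    finally show ?thesis .
  qed
  have t_hat: "t_hat A1 A2 C = tmin"
    unfolding t_hat_def reverse_I_proj_def KL
    by (intro ext arg_min_unique) (simp add: J_tmin_less)
  have t_check: "t_check A1 A2 C = (\<lambda>e. - tmin (- e))"
    unfolding t_check_def I_proj_def KL'
    by (intro ext arg_min_unique) (simp add: J_tmin_less minus_equation_iff)
  have Dt: "Dt_hat A1 A2 C = tmin" "Dt_check A1 A2 C = (\<lambda>e. - tmin (- e))"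
    by (auto simp: Dt_hat_def Dt_check_def t_star t_hat t_check)

  have refl: "(deriv ^^ i) (\<lambda>e. - tmin (- e)) = (\<lambda>e. - ((- 1) ^ i * (deriv ^^ i) tmin (- e)))" for i
    using iterated_deriv_reflect[of tmin i 0 "- 1"] smooth_tmin by simp
  have sm: "smooth_near_0 tmin" "smooth_near_0 (\<lambda>e. - tmin (- e))"
  proof -
    show "smooth_near_0 tmin"
      unfolding smooth_near_0_def using smooth_tmin by (intro exI[of _ 1]) auto
    have "(deriv ^^ i) (\<lambda>e. - tmin (- e)) field_differentiable at x" for i x
      using smooth_reflect[of tmin i 0 "- 1"] smooth_tmin by simp
    then show "smooth_near_0 (\<lambda>e. - tmin (- e))"
      unfolding smooth_near_0_def by (intro exI[of _ 1]) auto
  qed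

  define h where "h e = tmin e + tmin (- e)" for e
  have hd: "(deriv ^^ i) h = (\<lambda>e. (deriv ^^ i) tmin e + (- 1) ^ i * (deriv ^^ i) tmin (- e))" for i
    using iterated_deriv_reflect[of tmin i 1 1] smooth_tmin by (simp add: h_def[abs_def])
  have hsmooth: "(deriv ^^ i) h field_differentiable at x" for i x
    using smooth_reflect[of tmin i 1 1] smooth_tmin by (simp add: h_def[abs_def])
  have taylor: "(\<lambda>e. h e - (\<Sum>j\<le>2*n. (deriv ^^ j) h 0 / fact j * e ^ j)) \<in> O[at 0](\<lambda>e. e ^ (2*n + 2))" for n
  proof -
    \<comment> \<open>\<open>h\<close> is even, so its coefficient of degree
      \<open>2 * n + 1\<close> vanishes, and the polynomial of degree \<open>2 * n\<close> already
      has an error of order \<open>2 * n + 2\<close>.\<close>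
    have "(deriv ^^ Suc (2 * n)) h 0 = 0" unfolding hd by simp
    moreover have "{..<2 * n + 2} = insert (Suc (2 * n)) {..2 * n}" by auto
    ultimately show ?thesis using taylor_bigo[OF hsmooth, where n = "2 * n + 2"] by simp
  qed
  have h: "t_hat A1 A2 C e - t_check A1 A2 C e = h e" for e by (simp add: t_hat t_check h_def)

  have "(\<lambda>e. h e - (deriv ^^ 2) tmin 0 * e ^ 2) \<in> O[at 0](\<lambda>e. e ^ 4)"
  proof -
    \<comment> \<open>The second derivative of \<open>h\<close> at 0 is twice that of
      \<open>tmin\<close>, which cancels the factorial; the lower coefficients are 0.\<close>
    have "(\<Sum>j\<le>2. (deriv ^^ j) h 0 / fact j * e ^ j) = (deriv ^^ 2) tmin 0 * e ^ 2" for e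
      unfolding hd by (simp add: numeral_2_eq_2 tmin_0)
    then show ?thesis using taylor[of 1] by simp
  qed
  moreover have "(deriv ^^ 2) tmin 0 = trace (log_m (whiten A1 C) ** log_m (whiten A1 C) ** log_m (whiten A1 A2)) / (nat_dist A1 A2)\<^sup>2"
  proof -
    have "spec V k \<bullet> spec U l = 0" using orth by (simp add: inner_commute)
    then have "(\<Sum>p\<in>UNIV. w p * kk p * ll p) = 0"
      using pairs[of "\<lambda>x y. x * y"] by (simp add: inner_spec mult.assoc)
    from deriv2_tmin[OF this]
    have "(deriv ^^ 2) tmin 0 = (\<Sum>p\<in>UNIV. w p * (kk p)\<^sup>2 * ll p) / (\<Sum>p\<in>UNIV. w p * (ll p)\<^sup>2)" .
    \<comment> \<open>This is where the squared distance in the denominator comes from.\<close>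
    also have "(\<Sum>p\<in>UNIV. w p * (ll p)\<^sup>2) = (norm l)\<^sup>2"
      using pairs[of "\<lambda>x y. y\<^sup>2"] by (simp add: sum_overlap_right[OF V U] norm_vec_square)
    also have "(\<Sum>p\<in>UNIV. w p * (kk p)\<^sup>2 * ll p) = trace (spec V (\<chi> i. (k $ i)\<^sup>2) ** spec U l)"
      using pairs[of "\<lambda>x y. x\<^sup>2 * y"] by (simp add: trace_spec_mult mult.assoc)
    also have "spec V (\<chi> i. (k $ i)\<^sup>2) = log_m (whiten A1 C) ** log_m (whiten A1 C)"
      by (simp add: k log_m_spec spec_mult V power2_eq_square)
    also have "spec U l = log_m (whiten A1 A2)" by (simp add: l log_m_spec U)
    finally show ?thesis by (simp add: norml)
  qed
  ultimately show ?thesis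
    unfolding t_star dist0 normk Dt h refl using sm taylor by simp
qed

end
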